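(* Assume the spectral gap condition and the removable singularity condition (both stated in the context), and let $0<r_1\le r_0$. Let $f\in H^*$, $0<\varepsilon<1$, $\theta\in\Theta$, and let $u_{\varepsilon,\theta}\in H$ be the solution of $$\varepsilon^{-2}a_\theta(u_{\varepsilon,\theta},\tilde u)+b_\theta(u_{\varepsilon,\theta},\tilde u)=\langle f,\tilde u\rangle\qquad\forall \tilde u\in H.$$ Define $$u^{(0)}_{\varepsilon,\theta}:=\begin{cases} v_{\varepsilon,\theta}+\mathcal M_\theta z_{\varepsilon,\theta}, & |\theta|<r_1,\\ v_\theta, & |\theta|\ge r_1,\end{cases}$$ where, for $|\theta|<r_1$, the pair $(v_{\varepsilon,\theta},z_{\varepsilon,\theta})\in V^\star_\theta\times Z$ is the solution of $$\varepsilon^{-2}a_\theta(\mathcal M_\theta z_{\varepsilon,\theta},\mathcal M_\theta\tilde z)+b_\theta(v_{\varepsilon,\theta}+\mathcal M_\theta z_{\varepsilon,\theta},\tilde v+\mathcal M_\theta\tilde z)=\langle f,\tilde v+\mathcal M_\theta\tilde z\rangle\qquad\forall\tilde v\in V_\theta^\star,\ \forall\tilde z\in Z,$$ and, for $|\theta|\ge r_1$, $v_\theta\in V_\theta=V_\theta^\star$ is the solution of $b_\theta(v_\theta,\tilde v)=\langle f,\tilde v\rangle$ for all $\tilde v\in V_\theta$. Then for all $\theta\in\Theta$ and $0<\varepsilon<1$, $$\varepsilon^{-2}a_\theta[u_{\varepsilon,\theta}-u^{(0)}_{\varepsilon,\theta}]+b_\theta[u_{\varepsilon,\theta}-u^{(0)}_{\varepsilon,\theta}]\le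 C_1\varepsilon^2\|f\|_{*\theta}^2,\qquad C_1=\max\{8K^2\nu_0^{-1},\,1/\nu(r_1)\},$$ $$b_\theta[u_{\varepsilon,\theta}-u^{(0)}_{\varepsilon,\theta}]\le C_2\varepsilon^4\|f\|_{*\theta}^2,\qquad C_2=\max\{16K^4\nu_0^{-2},\,1/\nu^2(r_1)\},$$ where $\nu(r_1):=\inf\{\nu_\theta:\theta\in\Theta,\ |\theta|\ge r_1\}$, which is positive.
   Context: $H$ is a separable complex Hilbert space, $n\ge 1$, $\Theta\subset\mathbb R^n$ is compact, and for each $\theta\in\Theta$, $a_\theta$ and $b_\theta$ are non-negative sesquilinear forms on $H\times H$. For a sesquilinear form $\mathfrak b$ write $\mathfrak b[u]:=\mathfrak b(u,u)$. Standing assumptions: for each $\theta$, $(u,\tilde u)_\theta:=a_\theta(u,\tilde u)+b_\theta(u,\tilde u)$ is an inner product on $H$ equivalent to the original one, with norm $\|\cdot\|_\theta$; there is $K>0$ with $\|u\|_{\theta_1}\le K\|u\|_{\theta_2}$ for all $u\in H$, $\theta_1,\theta_2\in\Theta$; there is $L_a>0$ with $|a_{\theta_1}(u,\tilde u)-a_{\theta_2}(u,\tilde u)|\le L_a|\theta_1-\theta_2|\,\|u\|_{\theta_1}\|\tilde u\|_{\theta_1}$ for all $u,\tilde u\in H$, $\theta_1,\theta_2\in\Theta$. $H^*$ is the space of antilinear continuous functionals on $H$, and $\|f\|_{*\theta}:=\sup_{u\ne0}|\langle f,u\rangle|/\|u\|_\theta$. $V_\theta:=\{v\in H: a_\theta[v]=0\}$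 (a closed subspace), $W_\theta:=\{w\in H:(w,v)_\theta=0\ \forall v\in V_\theta\}$. Spectral gap condition: for every $\theta\in\Theta$ there is $\nu_\theta>0$ with $a_\theta[w]\ge\nu_\theta\|w\|_\theta^2$ for all $w\in W_\theta$. Here $\nu_\theta$ denotes the largest such constant (with $\nu_\theta:=1$ if $W_\theta=\{0\}$). Removable singularity condition: $0\in\Theta$ is not an isolated point of $\Theta$ and there are a closed subspace $V_\star\subset H$ and $L_\star\ge0$ such that, with $V^\star_\theta:=V_\theta$ for $\theta\ne0$ and $V^\star_0:=V_\star$, one has $\inf_{v_2\in V^\star_{\theta_2}}\|v_1-v_2\|_{\theta_2}\le L_\star|\theta_1-\theta_2|\,\|v_1\|_{\theta_1}$ for all $v_1\in V^\star_{\theta_1}$, $\theta_1,\theta_2\in\Theta$. (Then $V_\star\subset V_0$.) $Z$ is a fixed closed subspace of $V_0$ with $V_0=V_\star\dot+Z$ (direct sum) and, for some $0\le K_Z<1$, $|(v_\star,z)_0|\le K_Z\|v_\star\|_0\|z\|_0$ for all $v_\star\in V_\star$, $z\in Z$. For $\theta\in\Theta$ with $|\theta|\le\nu_0/(2L_a)$, $\mathcal N_\theta:V_0\to W_0$ is the linear map defined by: $\mathcal N_\theta v_0\in W_0$ is the unique solution of $a_\theta(\mathcal N_\theta v_0,\tilde w_0)=-a_\theta(v_0,\tilde w_0)$ for all $\tilde w_0\in W_0$; and $\mathcal M_\theta v_0:=v_0+\mathcal N_\theta v_0$. $r_0:=\nu_0/(2L_a)$ if $L_\star=0$, and $r_0:=\min\{\nu_0/(2L_a),\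 (1-K_Z)/(3KL_\star)\}$ otherwise. *)

theory Defs
  imports "HOL-Analysis.Analysis"
begin

text \<open>
  Sesquilinear forms, the inner product included, are linear in the first and antilinear in
  the second argument.
\<close>

class chilbert_space = banach +
  fixes scaleC :: "complex \<Rightarrow> 'a \<Rightarrow> 'a" (infixr "*\<^sub>C" 75)
    and cinner :: "'a \<Rightarrow> 'a \<Rightarrow> complex"
  assumes scaleC_add_right: "c *\<^sub>C (x + y) = c *\<^sub>C x + c *\<^sub>C y"
    and scaleC_add_left: "(c + d) *\<^sub>C x = c *\<^sub>C x + d *\<^sub>C x"
    and scaleC_scaleC: "c *\<^sub>C (d *\<^sub>C x) = (c * d) *\<^sub>C x"
    and scaleR_scaleC: "r *\<^sub>R x = complex_of_real r *\<^sub>C x"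
    and cinner_add_left: "cinner (x + y) z = cinner x z + cinner y z"
    and cinner_scaleC_left: "cinner (c *\<^sub>C x) y = c * cinner x y"
    and cinner_commute: "cinner y x = cnj (cinner x y)"
    and cinner_self: "cinner x x = complex_of_real ((norm x)\<^sup>2)"

definition csubspace :: "'h::chilbert_space set \<Rightarrow> bool" where
  "csubspace S \<longleftrightarrow> 0 \<in> S \<and> (\<forall>x\<in>S. \<forall>y\<in>S. x + y \<in> S) \<and> (\<forall>c. \<forall>x\<in>S. c *\<^sub>C x \<in> S)"

definition closed_csubspace :: "'h::chilbert_space set \<Rightarrow> bool" where
  "closed_csubspace S \<longleftrightarrow> csubspace S \<and> closed S"

type_synonym 'h form = "'h \<Rightarrow> 'h \<Rightarrow> complex"

definition sesquilinear :: "'h::chilbert_space form \<Rightarrow> bool" where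
  "sesquilinear q \<longleftrightarrow>
     (\<forall>x y z. q (x + y) z = q x z + q y z) \<and> (\<forall>c x y. q (c *\<^sub>C x) y = c * q x y) \<and>
     (\<forall>x y z. q x (y + z) = q x y + q x z) \<and> (\<forall>c x y. q x (c *\<^sub>C y) = cnj c * q x y)"

definition nonneg_form :: "'h form \<Rightarrow> bool" where
  "nonneg_form q \<longleftrightarrow> (\<forall>u. q u u \<in> \<real> \<and> 0 \<le> Re (q u u))"

text \<open>The diagonal \<open>q[u]\<close>; it is only used for non-negative forms, where \<open>q u u\<close> is real.\<close>

definition qform :: "'h form \<Rightarrow> 'h \<Rightarrow> real" where
  "qform q u = Re (q u u)"

definition is_inner_product :: "'h::chilbert_space form \<Rightarrow> bool" where
  "is_inner_product p \<longleftrightarrow> sesquilinear p \<and> (\<forall>x y. p y x = cnj (p x y)) \<and>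
     nonneg_form p \<and> (\<forall>x. p x x = 0 \<longrightarrow> x = 0)"

definition form_sum :: "'h form \<Rightarrow> 'h form \<Rightarrow> 'h form" where
  "form_sum q p u w = q u w + p u w"

definition form_norm :: "'h form \<Rightarrow> 'h \<Rightarrow> real" where
  "form_norm p u = sqrt (qform p u)"

definition equivalent_to_norm :: "'h::chilbert_space form \<Rightarrow> bool" where
  "equivalent_to_norm p \<longleftrightarrow>
     (\<exists>c>0. \<exists>C>0. \<forall>u. c * norm u \<le> form_norm p u \<and> form_norm p u \<le> C * norm u)"

definition antidual :: "('h::chilbert_space \<Rightarrow> complex) set" where
  "antidual = {f. (\<forall>x y. f (x + y) = f x + f y) \<and> (\<forall>c x. f (c *\<^sub>C x) = cnj c * f x) \<and>
     continuous_on UNIV f}"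

text \<open>The supremum is over a nonempty set unless \<open>'h\<close> is the zero space.\<close>

definition dual_norm :: "'h::chilbert_space form \<Rightarrow> ('h \<Rightarrow> complex) \<Rightarrow> real" where
  "dual_norm p f = (SUP u\<in>{u. u \<noteq> 0}. cmod (f u) / form_norm p u)"

type_synonym ('n, 'h) form_family = "real ^ 'n \<Rightarrow> 'h form"

definition ip :: "('n, 'h) form_family \<Rightarrow> ('n, 'h) form_family \<Rightarrow> ('n, 'h) form_family" where
  "ip a b \<theta> = form_sum (a \<theta>) (b \<theta>)"

definition tnorm :: "('n, 'h) form_family \<Rightarrow> ('n, 'h) form_family \<Rightarrow> real ^ 'n \<Rightarrow> 'h \<Rightarrow> real" where
  "tnorm a b \<theta> = form_norm (ip a b \<theta>)"

definition standing_assumptions ::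
  "(real ^ 'n::finite) set \<Rightarrow> ('n, 'h::chilbert_space) form_family \<Rightarrow> ('n, 'h) form_family \<Rightarrow>
   real \<Rightarrow> real \<Rightarrow> bool" where
  "standing_assumptions \<Theta> a b K La \<longleftrightarrow>
     compact \<Theta> \<and>
     (\<forall>\<theta>\<in>\<Theta>. sesquilinear (a \<theta>) \<and> nonneg_form (a \<theta>) \<and>
             sesquilinear (b \<theta>) \<and> nonneg_form (b \<theta>) \<and>
             is_inner_product (ip a b \<theta>) \<and> equivalent_to_norm (ip a b \<theta>)) \<and>
     K > 0 \<and> (\<forall>\<theta>1\<in>\<Theta>. \<forall>\<theta>2\<in>\<Theta>. \<forall>u. tnorm a b \<theta>1 u \<le> K * tnorm a b \<theta>2 u) \<and>
     La > 0 \<and> (\<forall>\<theta>1\<in>\<Theta>. \<forall>\<theta>2\<in>\<Theta>. \<forall>u w.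
        cmod (a \<theta>1 u w - a \<theta>2 u w) \<le> La * norm (\<theta>1 - \<theta>2) * tnorm a b \<theta>1 u * tnorm a b \<theta>1 w)"

definition kerV :: "('n, 'h) form_family \<Rightarrow> real ^ 'n \<Rightarrow> 'h set" where
  "kerV a \<theta> = {v. qform (a \<theta>) v = 0}"

definition orthW :: "('n, 'h) form_family \<Rightarrow> ('n, 'h) form_family \<Rightarrow> real ^ 'n \<Rightarrow> 'h set" where
  "orthW a b \<theta> = {w. \<forall>v\<in>kerV a \<theta>. ip a b \<theta> w v = 0}"

definition gap_bound ::
  "('n, 'h) form_family \<Rightarrow> ('n, 'h) form_family \<Rightarrow> real ^ 'n \<Rightarrow> real \<Rightarrow> bool" where
  "gap_bound a b \<theta> c \<longleftrightarrow> c > 0 \<and> (\<forall>w\<in>orthW a b \<theta>. qform (a \<theta>) w \<ge> c * (tnorm a b \<theta> w)\<^sup>2)"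

definition spectral_gap ::
  "(real ^ 'n) set \<Rightarrow> ('n, 'h) form_family \<Rightarrow> ('n, 'h) form_family \<Rightarrow> bool" where
  "spectral_gap \<Theta> a b \<longleftrightarrow> (\<forall>\<theta>\<in>\<Theta>. \<exists>c. gap_bound a b \<theta> c)"

definition nu ::
  "('n, 'h::zero) form_family \<Rightarrow> ('n, 'h) form_family \<Rightarrow> real ^ 'n \<Rightarrow> real" where
  "nu a b \<theta> = (if orthW a b \<theta> = {0} then 1 else (GREATEST c. gap_bound a b \<theta> c))"

text \<open>
  Extended-real valued: if no \<open>\<theta> \<in> \<Theta>\<close> has \<open>norm \<theta> \<ge> r\<close>, the infimum is \<open>\<infinity>\<close> and its reciprocal
  is \<open>0\<close>.
\<close>

definition nu_inf ::
  "(real ^ 'n::finite) set \<Rightarrow> ('n, 'h::zero) form_family \<Rightarrow> ('n, 'h) form_family \<Rightarrow> real \<Rightarrow> ereal" where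
  "nu_inf \<Theta> a b r = (INF \<theta>\<in>{\<theta>\<in>\<Theta>. norm \<theta> \<ge> r}. ereal (nu a b \<theta>))"

definition Vst :: "('n::finite, 'h) form_family \<Rightarrow> 'h set \<Rightarrow> real ^ 'n \<Rightarrow> 'h set" where
  "Vst a Vs \<theta> = (if \<theta> = 0 then Vs else kerV a \<theta>)"

definition removable_singularity ::
  "(real ^ 'n::finite) set \<Rightarrow> ('n, 'h::chilbert_space) form_family \<Rightarrow> ('n, 'h) form_family \<Rightarrow>
   'h set \<Rightarrow> real \<Rightarrow> bool" where
  "removable_singularity \<Theta> a b Vs Ls \<longleftrightarrow>
     0 \<in> \<Theta> \<and> \<not> 0 isolated_in \<Theta> \<and> closed_csubspace Vs \<and> Ls \<ge> 0 \<and>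
     (\<forall>\<theta>1\<in>\<Theta>. \<forall>\<theta>2\<in>\<Theta>. \<forall>v1\<in>Vst a Vs \<theta>1.
        (INF v2\<in>Vst a Vs \<theta>2. tnorm a b \<theta>2 (v1 - v2)) \<le> Ls * norm (\<theta>1 - \<theta>2) * tnorm a b \<theta>1 v1)"

definition complementary ::
  "('n::finite, 'h::chilbert_space) form_family \<Rightarrow> ('n, 'h) form_family \<Rightarrow>
   'h set \<Rightarrow> 'h set \<Rightarrow> real \<Rightarrow> bool" where
  "complementary a b Vs Z KZ \<longleftrightarrow>
     closed_csubspace Z \<and> kerV a 0 = {v + z | v z. v \<in> Vs \<and> z \<in> Z} \<and> Vs \<inter> Z = {0} \<and>
     0 \<le> KZ \<and> KZ < 1 \<and>
     (\<forall>v\<in>Vs. \<forall>z\<in>Z. cmod (ip a b 0 v z) \<le> KZ * tnorm a b 0 v * tnorm a b 0 z)"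

text \<open>
  Solutions of variational problems, here and below, are definite descriptions: that they exist
  and are unique is not assumed anywhere.
\<close>

definition mapN ::
  "('n::finite, 'h) form_family \<Rightarrow> ('n, 'h) form_family \<Rightarrow> real ^ 'n \<Rightarrow> 'h \<Rightarrow> 'h" where
  "mapN a b \<theta> v = (THE w. w \<in> orthW a b 0 \<and> (\<forall>w'\<in>orthW a b 0. a \<theta> w w' = - a \<theta> v w'))"

definition mapM ::
  "('n::finite, 'h::plus) form_family \<Rightarrow> ('n, 'h) form_family \<Rightarrow> real ^ 'n \<Rightarrow> 'h \<Rightarrow> 'h" where
  "mapM a b \<theta> v = v + mapN a b \<theta> v"

definition radius_r0 ::
  "('n::finite, 'h::zero) form_family \<Rightarrow> ('n, 'h) form_family \<Rightarrow>
   real \<Rightarrow> real \<Rightarrow> real \<Rightarrow> real \<Rightarrow> real" where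
  "radius_r0 a b K La Ls KZ =
     (if Ls = 0 then nu a b 0 / (2 * La)
      else min (nu a b 0 / (2 * La)) ((1 - KZ) / (3 * K * Ls)))"

definition energy ::
  "('n, 'h) form_family \<Rightarrow> ('n, 'h) form_family \<Rightarrow> real \<Rightarrow> real ^ 'n \<Rightarrow> 'h \<Rightarrow> real" where
  "energy a b \<epsilon> \<theta> u = qform (a \<theta>) u / \<epsilon>\<^sup>2 + qform (b \<theta>) u"

definition u_sol ::
  "('n, 'h) form_family \<Rightarrow> ('n, 'h) form_family \<Rightarrow> ('h \<Rightarrow> complex) \<Rightarrow> real \<Rightarrow> real ^ 'n \<Rightarrow> 'h" where
  "u_sol a b f \<epsilon> \<theta> = (THE u. \<forall>u'. complex_of_real (1 / \<epsilon>\<^sup>2) * a \<theta> u u' + b \<theta> u u' = f u')"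

definition vz_sol ::
  "('n::finite, 'h::plus) form_family \<Rightarrow> ('n, 'h) form_family \<Rightarrow> 'h set \<Rightarrow> 'h set \<Rightarrow>
   ('h \<Rightarrow> complex) \<Rightarrow> real \<Rightarrow> real ^ 'n \<Rightarrow> 'h \<times> 'h" where
  "vz_sol a b Vs Z f \<epsilon> \<theta> = (THE (v, z). v \<in> Vst a Vs \<theta> \<and> z \<in> Z \<and>
     (\<forall>v'\<in>Vst a Vs \<theta>. \<forall>z'\<in>Z.
        complex_of_real (1 / \<epsilon>\<^sup>2) * a \<theta> (mapM a b \<theta> z) (mapM a b \<theta> z') +
        b \<theta> (v + mapM a b \<theta> z) (v' + mapM a b \<theta> z') = f (v' + mapM a b \<theta> z')))"

definition v_sol ::
  "('n, 'h) form_family \<Rightarrow> ('n, 'h) form_family \<Rightarrow> ('h \<Rightarrow> complex) \<Rightarrow> real ^ 'n \<Rightarrow> 'h" where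
  "v_sol a b f \<theta> = (THE v. v \<in> kerV a \<theta> \<and> (\<forall>v'\<in>kerV a \<theta>. b \<theta> v v' = f v'))"

definition u0_approx ::
  "('n::finite, 'h::plus) form_family \<Rightarrow> ('n, 'h) form_family \<Rightarrow> 'h set \<Rightarrow> 'h set \<Rightarrow> real \<Rightarrow>
   ('h \<Rightarrow> complex) \<Rightarrow> real \<Rightarrow> real ^ 'n \<Rightarrow> 'h" where
  "u0_approx a b Vs Z r1 f \<epsilon> \<theta> =
     (if norm \<theta> < r1 then (case vz_sol a b Vs Z f \<epsilon> \<theta> of (v, z) \<Rightarrow> v + mapM a b \<theta> z)
      else v_sol a b f \<theta>)"

definition const_C1 ::
  "(real ^ 'n::finite) set \<Rightarrow> ('n, 'h::zero) form_family \<Rightarrow> ('n, 'h) form_family \<Rightarrow>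
   real \<Rightarrow> real \<Rightarrow> ereal" where
  "const_C1 \<Theta> a b K r1 = max (ereal (8 * K\<^sup>2 / nu a b 0)) (1 / nu_inf \<Theta> a b r1)"

definition const_C2 ::
  "(real ^ 'n::finite) set \<Rightarrow> ('n, 'h::zero) form_family \<Rightarrow> ('n, 'h) form_family \<Rightarrow>
   real \<Rightarrow> real \<Rightarrow> ereal" where
  "const_C2 \<Theta> a b K r1 = max (ereal (16 * K ^ 4 / (nu a b 0)\<^sup>2)) (1 / (nu_inf \<Theta> a b r1)\<^sup>2)"

end

theory Submission
  imports Defs
begin

text \<open>
  For \<open>\<bar>\<theta>\<bar> \<ge> r1\<close> the \<open>V\<close>-component of the exact solution is the approximation itself, and the
  \<open>W\<close>-component is controlled by the spectral gap, which is bounded below there by compactness and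
  because \<open>V\<close> varies continuously away from \<open>0\<close>.

  For \<open>\<bar>\<theta>\<bar> < r1\<close> the key point is that the trial space \<open>{v + M z}\<close> is exactly the
  \<open>a\<^sub>\<theta>\<close>-orthogonal complement of \<open>W\<^sub>0\<close>. Indeed \<open>Z + W\<^sub>0\<close> is a complement of \<open>V\<^sub>\<star>\<close> in \<open>H\<close>, at
  an angle controlled by \<open>K\<^sub>Z\<close>; it therefore remains a complement of the nearby space
  \<open>V\<^sup>\<star>\<^sub>\<theta>\<close>. Galerkin orthogonality and the coercivity of \<open>a\<^sub>\<theta>\<close> on \<open>W\<^sub>0\<close> then give the estimates.
\<close>

section \<open>Non-negative forms and the Riesz representation\<close>

lemma scaleC_minus1: "(-1) *\<^sub>C (x::'h::chilbert_space) = - x"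
  using scaleR_scaleC[of "-1" x] by simp

lemma csubspace_diff: "csubspace S \<Longrightarrow> x \<in> S \<Longrightarrow> y \<in> S \<Longrightarrow> x - y \<in> S"
  unfolding csubspace_def by (metis scaleC_minus1 diff_conv_add_uminus)

lemma closed_csubspace_diff: "closed_csubspace S \<Longrightarrow> x \<in> S \<Longrightarrow> y \<in> S \<Longrightarrow> x - y \<in> S"
  by (simp add: closed_csubspace_def csubspace_diff)

lemma csubspace_scaleR: "csubspace S \<Longrightarrow> x \<in> S \<Longrightarrow> r *\<^sub>R x \<in> S"
  by (simp add: csubspace_def scaleR_scaleC)

lemma real_quadratic_nonneg_imp_discriminant:
  fixes A B D :: real
  assumes "\<And>s. 0 \<le> A - 2 * s * D + s\<^sup>2 * D * B" "0 \<le> D" "0 \<le> B"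
  shows "D \<le> A * B"
proof (cases "B = 0")
  case True
  show ?thesis
  proof (rule ccontr)
    assume "\<not> ?thesis"
    then have "D > 0" using True by simp
    with assms(1)[of "(A + 1) / (2 * D)"] True show False by (simp add: field_simps)
  qed
next
  case False
  with assms(1)[of "1 / B"] assms(2,3) show ?thesis
    by (simp add: field_simps power2_eq_square)
qed

lemma square_le_mult_imp_le:
  fixes q B :: real
  assumes "q\<^sup>2 \<le> q * B" "0 \<le> q" "0 \<le> B"
  shows "q \<le> B"
proof (cases "q = 0")
  case False
  with assms show ?thesis by (simp add: power2_eq_square mult_le_cancel_left)
qed (use assms in simp)

locale nonneg_sesquilinear =
  fixes q :: "'h::chilbert_space form"
  assumes sesquilinear: "sesquilinear q" and nonneg: "nonneg_form q"
begin

lemma add_left: "q (x + y) z = q x z + q y z"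
  and scaleC_left: "q (c *\<^sub>C x) y = c * q x y"
  and add_right: "q x (y + z) = q x y + q x z"
  and scaleC_right: "q x (c *\<^sub>C y) = cnj c * q x y"
  using sesquilinear unfolding sesquilinear_def by blast+

lemma minus_left [simp]: "q (- x) y = - q x y"
  using scaleC_left[of "-1" x y] by (simp add: scaleC_minus1)

lemma minus_right [simp]: "q x (- y) = - q x y"
  using scaleC_right[of x "-1" y] by (simp add: scaleC_minus1)

lemma diff_left: "q (x - y) z = q x z - q y z"
  using add_left[of x "- y" z] by simp

lemma diff_right: "q x (y - z) = q x y - q x z"
  using add_right[of x y "- z"] by simp

lemma zero_left [simp]: "q 0 y = 0"
  using diff_left[of 0 0 y] by simp

lemma zero_right [simp]: "q x 0 = 0"
  using diff_right[of x 0 0] by simp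

lemma self_eq: "q u u = complex_of_real (qform q u)"
  using nonneg by (simp add: nonneg_form_def qform_def)

lemma qform_nonneg [simp]: "0 \<le> qform q u"
  using nonneg by (simp add: nonneg_form_def qform_def)

lemma qform_0 [simp]: "qform q 0 = 0"
  by (simp add: qform_def)

lemma hermitian: "q y x = cnj (q x y)"
proof -
  have "Im (q (x + y) (x + y)) = 0" "Im (q x x) = 0" "Im (q y y) = 0"
    by (simp_all only: self_eq Im_complex_of_real)
  then have im: "Im (q y x) = - Im (q x y)"
    by (simp add: add_left add_right)
  have "Im (q (x + \<i> *\<^sub>C y) (x + \<i> *\<^sub>C y)) = 0" "Im (q x x) = 0" "Im (q y y) = 0"
    by (simp_all only: self_eq Im_complex_of_real)
  then have "Re (q y x) = Re (q x y)"
    by (simp add: add_left add_right scaleC_left scaleC_right)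
  with im show ?thesis by (simp add: complex_eq_iff)
qed

lemma qform_add_scaleC:
  "qform q (x + t *\<^sub>C y) = qform q x + 2 * Re (cnj t * q x y) + (cmod t)\<^sup>2 * qform q y"
proof -
  have "Re (q y x) = Re (q x y)" "Im (q y x) = - Im (q x y)"
    using hermitian[of x y] by simp_all
  then show ?thesis
    unfolding cmod_power2 qform_def add_left add_right scaleC_left scaleC_right
    by (simp add: power2_eq_square algebra_simps)
qed

lemma qform_scaleC: "qform q (t *\<^sub>C x) = (cmod t)\<^sup>2 * qform q x"
  using qform_add_scaleC[of 0 t x] by simp

lemma qform_add: "qform q (x + y) = qform q x + 2 * Re (q x y) + qform q y"
  using hermitian[of x y] by (simp add: qform_def add_left add_right)

lemma qform_minus [simp]: "qform q (- x) = qform q x"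
  by (simp add: qform_def)

lemma qform_diff: "qform q (x - y) = qform q x - 2 * Re (q x y) + qform q y"
  using qform_add[of x "- y"] by simp

lemma Cauchy_Schwarz_square: "(cmod (q x y))\<^sup>2 \<le> qform q x * qform q y"
proof (rule real_quadratic_nonneg_imp_discriminant)
  fix s :: real
  have "0 \<le> qform q (x + (- of_real s * q x y) *\<^sub>C y)" by simp
  also have "\<dots> = qform q x - 2 * s * (cmod (q x y))\<^sup>2 + s\<^sup>2 * (cmod (q x y))\<^sup>2 * qform q y"
    unfolding qform_add_scaleC cmod_power2 by (simp add: power2_eq_square algebra_simps)
  finally show "0 \<le> \<dots>" .
qed auto

lemma form_norm_nonneg [simp]: "0 \<le> form_norm q x"
  by (simp add: form_norm_def)

lemma form_norm_0 [simp]: "form_norm q 0 = 0"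
  by (simp add: form_norm_def)

lemma form_norm_square: "(form_norm q x)\<^sup>2 = qform q x"
  by (simp add: form_norm_def)

lemma Cauchy_Schwarz: "cmod (q x y) \<le> form_norm q x * form_norm q y"
  by (rule power2_le_imp_le) (simp_all add: power_mult_distrib form_norm_square Cauchy_Schwarz_square)

lemma form_norm_triangle: "form_norm q (x + y) \<le> form_norm q x + form_norm q y"
proof (rule power2_le_imp_le)
  have "Re (q x y) \<le> form_norm q x * form_norm q y"
    using Cauchy_Schwarz complex_Re_le_cmod order_trans by blast
  then show "(form_norm q (x + y))\<^sup>2 \<le> (form_norm q x + form_norm q y)\<^sup>2"
    by (simp add: power2_sum form_norm_square qform_add)
qed simp

lemma form_norm_minus [simp]: "form_norm q (- x) = form_norm q x"
  by (simp add: form_norm_def)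

lemma form_norm_minus_commute: "form_norm q (x - y) = form_norm q (y - x)"
  using form_norm_minus[of "x - y"] by simp

lemma qform_zero_imp_left: "qform q x = 0 \<Longrightarrow> q x y = 0"
  using Cauchy_Schwarz_square[of x y] by simp

lemma qform_zero_imp_right: "qform q x = 0 \<Longrightarrow> q y x = 0"
  using Cauchy_Schwarz_square[of y x] by simp

lemma qform_zero_iff: "qform q x = 0 \<longleftrightarrow> (\<forall>y. q x y = 0)"
  by (metis qform_def qform_zero_imp_left zero_complex.sel(1))

lemma bounded_bilinearI:
  assumes "\<And>x. form_norm q x \<le> C * norm x"
  shows "bounded_bilinear q"
proof
  show "\<exists>K. \<forall>x y. norm (q x y) \<le> norm x * norm y * K"
  proof (intro exI[of _ "C * C"] allI)
    fix x y
    have "cmod (q x y) \<le> form_norm q x * form_norm q y" by (rule Cauchy_Schwarz)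
    also have "\<dots> \<le> (C * norm x) * (C * norm y)"
      using assms form_norm_nonneg order_trans by (intro mult_mono) (blast+)
    finally show "norm (q x y) \<le> norm x * norm y * (C * C)" by (simp add: algebra_simps)
  qed
qed (simp_all add: add_left add_right scaleR_scaleC scaleC_left scaleC_right scaleR_conv_of_real)

lemma solution_unique:
  assumes "csubspace S" "\<And>x. x \<in> S \<Longrightarrow> qform q x = 0 \<Longrightarrow> x = 0"
    and "u \<in> S" "u' \<in> S" "\<And>w. w \<in> S \<Longrightarrow> q u w = q u' w"
  shows "u = u'"
proof -
  have "u - u' \<in> S" using assms csubspace_diff by blast
  moreover from this have "q (u - u') (u - u') = 0"
    by (simp add: assms(5) diff_left)
  ultimately show ?thesis using assms(2)[of "u - u'"] by (simp add: qform_def)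
qed

text \<open>The solution is obtained as the minimiser over \<open>S\<close> of the functional \<open>q[u] - 2 Re f(u)\<close>.\<close>

lemma Riesz_on_subspace:
  assumes S: "closed_csubspace S"
    and bil: "bounded_bilinear q"
    and c: "c > 0" and coercive: "\<And>x. x \<in> S \<Longrightarrow> c * (norm x)\<^sup>2 \<le> qform q x"
    and f: "bounded_linear f" and f_scaleC: "\<And>t x. f (t *\<^sub>C x) = cnj t * f x"
  shows "\<exists>u\<in>S. \<forall>w\<in>S. q u w = f w"
proof -
  have cs: "csubspace S" and cl: "closed S"
    using S by (auto simp: closed_csubspace_def)
  have S0: "0 \<in> S" and S_add: "\<And>x y. x \<in> S \<Longrightarrow> y \<in> S \<Longrightarrow> x + y \<in> S"
    and S_scaleC: "\<And>t x. x \<in> S \<Longrightarrow> t *\<^sub>C x \<in> S"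
    using cs by (auto simp: csubspace_def)
  interpret f: bounded_linear f by fact
  interpret qb: bounded_bilinear q by fact
  obtain M where M: "M > 0" "\<And>x. cmod (f x) \<le> norm x * M"
    using f.pos_bounded by blast
  define J where "J u = qform q u - 2 * Re (f u)" for u
  have J_ge: "J u \<ge> - (M\<^sup>2 / c)" if "u \<in> S" for u
  proof -
    have "Re (f u) \<le> norm u * M" using M(2) complex_Re_le_cmod order_trans by blast
    moreover have "c * (norm u)\<^sup>2 - 2 * (norm u * M) + M\<^sup>2 / c = c * (norm u - M / c)\<^sup>2"
      using c by (simp add: power2_eq_square algebra_simps)
    then have "c * (norm u)\<^sup>2 - 2 * (norm u * M) + M\<^sup>2 / c \<ge> 0"
      using c by simp
    ultimately show ?thesis using coercive[OF that] by (simp add: J_def)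
  qed
  define m where "m = (INF u\<in>S. J u)"
  have bdd: "bdd_below (J ` S)" using J_ge by (auto intro!: bdd_belowI[of _ "- (M\<^sup>2 / c)"])
  have m_le: "m \<le> J u" if "u \<in> S" for u
    unfolding m_def using bdd that by (rule cINF_lower)
  have "\<exists>u. u \<in> S \<and> J u < m + inverse (real (Suc n))" for n
    using cInf_lessD[of "J ` S" "m + inverse (real (Suc n))"] S0
    by (auto simp: m_def)
  then obtain u where u: "\<And>n. u n \<in> S" "\<And>n. J (u n) < m + inverse (real (Suc n))"
    by metis
  have parallelogram: "qform q (x - y) \<le> 2 * (J x - m) + 2 * (J y - m)" if "x \<in> S" "y \<in> S" for x y
  proof -
    have "m \<le> J ((1/2) *\<^sub>R (x + y))"
      using that by (intro m_le csubspace_scaleR cs S_add)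
    also have "\<dots> = qform q x / 4 + Re (q x y) / 2 + qform q y / 4 - Re (f x) - Re (f y)"
      unfolding J_def scaleR_scaleC qform_scaleC qform_add
      by (simp add: power2_eq_square f_scaleC f.add add_divide_distrib)
    finally show ?thesis unfolding J_def qform_diff right_diff_distrib by linarith
  qed
  have "Cauchy u"
  proof (rule metric_CauchyI)
    fix e :: real assume e: "0 < e"
    obtain N where N: "inverse (real (Suc N)) < c * e\<^sup>2 / 4"
      using reals_Archimedean[of "c * e\<^sup>2 / 4"] c e by auto
    show "\<exists>N. \<forall>i\<ge>N. \<forall>j\<ge>N. dist (u i) (u j) < e"
    proof (intro exI[of _ N] allI impI)
      fix i j assume ij: "N \<le> i" "N \<le> j"
      have le: "inverse (real (Suc k)) < c * e\<^sup>2 / 4" if "N \<le> k" for k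
        using N that by (meson le_imp_inverse_le of_nat_0_less_iff of_nat_le_iff Suc_le_mono
            zero_less_Suc order_le_less_trans)
      have "c * (norm (u i - u j))\<^sup>2 \<le> qform q (u i - u j)"
        by (intro coercive csubspace_diff[OF cs] u)
      also have "\<dots> \<le> 2 * (J (u i) - m) + 2 * (J (u j) - m)"
        by (intro parallelogram u)
      also have "\<dots> < c * e\<^sup>2"
        using u(2)[of i] u(2)[of j] le[OF ij(1)] le[OF ij(2)]
        unfolding right_diff_distrib by linarith
      finally have "(norm (u i - u j))\<^sup>2 < e\<^sup>2" using c by simp
      then show "dist (u i) (u j) < e"
        using e by (simp add: dist_norm power2_less_imp_less)
    qed
  qed
  then obtain x where x: "u \<longlonglongrightarrow> x" using Cauchy_convergent convergent_def by blast
  have xS: "x \<in> S" using closed_sequentially[OF cl u(1) x] .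
  have "(\<lambda>n. J (u n)) \<longlonglongrightarrow> J x"
    unfolding J_def qform_def by (intro tendsto_intros qb.tendsto f.tendsto x)
  moreover have "(\<lambda>n. m + inverse (real (Suc n))) \<longlonglongrightarrow> m"
    using tendsto_add[OF tendsto_const LIMSEQ_inverse_real_of_nat, of m] by simp
  ultimately have Jx: "J x \<le> m"
    using u(2) by (intro LIMSEQ_le) (auto intro: less_imp_le)
  have "q x w = f w" if w: "w \<in> S" for w
  proof -
    define g where "g = q x w - f w"
    have "(cmod g)\<^sup>2 \<le> 0 * qform q w"
    proof (rule real_quadratic_nonneg_imp_discriminant)
      fix s :: real
      let ?t = "- of_real s * g"
      have "J x \<le> J (x + ?t *\<^sub>C w)"
        using Jx m_le[of "x + ?t *\<^sub>C w"] S_add S_scaleC xS w by fastforce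
      also have "\<dots> = J x + 2 * Re (cnj ?t * g) + (cmod ?t)\<^sup>2 * qform q w"
        unfolding J_def qform_add_scaleC by (simp add: f.add f_scaleC g_def algebra_simps)
      also have "\<dots> = J x - 2 * s * (cmod g)\<^sup>2 + s\<^sup>2 * (cmod g)\<^sup>2 * qform q w"
        unfolding cmod_power2 by (simp add: power2_eq_square algebra_simps)
      finally show "0 \<le> 0 - 2 * s * (cmod g)\<^sup>2 + s\<^sup>2 * (cmod g)\<^sup>2 * qform q w" by simp
    qed auto
    then show ?thesis by (simp add: g_def)
  qed
  with xS show ?thesis by blast
qed

end

lemma antidual_bounded_linear:
  assumes "f \<in> antidual"
  shows "bounded_linear f" "\<And>t x. f (t *\<^sub>C x) = cnj t * f x"
proof -
  have add: "f (x + y) = f x + f y" and sc: "f (t *\<^sub>C x) = cnj t * f x" for x y t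
    using assms by (auto simp: antidual_def)
  show "f (t *\<^sub>C x) = cnj t * f x" for t x by (rule sc)
  have scR: "f (r *\<^sub>R x) = r *\<^sub>R f x" for r x
    by (simp add: scaleR_scaleC sc scaleR_conv_of_real)
  have f0: "f 0 = 0" using scR[of 0 0] by simp
  have "continuous (at 0) f"
    using assms by (simp add: antidual_def continuous_on_eq_continuous_at)
  then obtain d where d: "d > 0" "\<And>x. norm x < d \<Longrightarrow> cmod (f x) < 1"
    unfolding continuous_at_eps_delta by (metis dist_0_norm f0 zero_less_one dist_norm diff_zero)
  show "bounded_linear f"
  proof (intro bounded_linear_intro[of f "2 / d"] add scR)
    fix x
    show "cmod (f x) \<le> norm x * (2 / d)"
    proof (cases "x = 0")
      case False
      define r where "r = d / (2 * norm x)"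
      have r: "r > 0" using d False by (simp add: r_def)
      have "norm (r *\<^sub>R x) < d" using d(1) False by (simp add: r_def)
      from d(2)[OF this] have "r * cmod (f x) < 1" using r by (simp add: scR)
      then show ?thesis using d(1) False by (simp add: r_def field_simps)
    qed (simp add: f0)
  qed
qed

section \<open>Complements with respect to an equivalent inner product\<close>

locale equivalent_inner_product = nonneg_sesquilinear p for p :: "'h::chilbert_space form" +
  assumes equivalent: "equivalent_to_norm p"
begin

lemma norm_lower:
  obtains c where "c > 0" "\<And>u. c * norm u \<le> form_norm p u"
  using equivalent unfolding equivalent_to_norm_def by blast

lemma norm_upper:
  obtains C where "C > 0" "\<And>u. form_norm p u \<le> C * norm u"
  using equivalent unfolding equivalent_to_norm_def by blast

lemma bounded_bilinear: "bounded_bilinear p"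
  by (rule norm_upper) (rule bounded_bilinearI)

lemma form_norm_eq_0_iff [simp]: "form_norm p u = 0 \<longleftrightarrow> u = 0"
proof
  assume u: "form_norm p u = 0"
  obtain c where "c > 0" "c * norm u \<le> form_norm p u" by (rule norm_lower) blast
  with u show "u = 0" by (simp add: mult_le_0_iff)
qed (simp add: form_norm_def)

lemma form_norm_pos_iff: "form_norm p u > 0 \<longleftrightarrow> u \<noteq> 0"
  using form_norm_nonneg[of u] form_norm_eq_0_iff[of u] by linarith

lemma qform_eq_0_iff [simp]: "qform p u = 0 \<longleftrightarrow> u = 0"
  using form_norm_eq_0_iff[of u] by (simp add: form_norm_def)

lemma dual_norm_bound:
  assumes "f \<in> antidual"
  shows "cmod (f u) \<le> \<bar>dual_norm p f\<bar> * form_norm p u"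
proof (cases "u = 0")
  case True
  interpret f: bounded_linear f using antidual_bounded_linear[OF assms] by blast
  show ?thesis using True by (simp add: f.zero)
next
  case False
  interpret f: bounded_linear f using antidual_bounded_linear[OF assms] by blast
  obtain M where M: "\<And>x. cmod (f x) \<le> norm x * M" using f.bounded by blast
  obtain c where c: "c > 0" "\<And>u. c * norm u \<le> form_norm p u" by (rule norm_lower) blast
  have "cmod (f x) / form_norm p x \<le> M / c" if "x \<noteq> 0" for x
  proof -
    have "cmod (f x) * c \<le> M * (c * norm x)"
      using M[of x] c(1) by (simp add: mult.commute mult.left_commute)
    also have "\<dots> \<le> M * form_norm p x"
    proof (rule mult_left_mono[OF c(2)])
      have "0 \<le> norm x * M" using M[of x] norm_ge_zero order_trans by blast
      then show "0 \<le> M" using that by (simp add: zero_le_mult_iff)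
    qed
    finally show ?thesis using c(1) that form_norm_pos_iff by (simp add: field_simps)
  qed
  then have "bdd_above ((\<lambda>u. cmod (f u) / form_norm p u) ` {u. u \<noteq> 0})"
    by (auto intro!: bdd_aboveI)
  then have "cmod (f u) / form_norm p u \<le> dual_norm p f"
    unfolding dual_norm_def using False by (intro cSUP_upper) auto
  then have "cmod (f u) / form_norm p u \<le> \<bar>dual_norm p f\<bar>" by linarith
  then show ?thesis using False form_norm_pos_iff by (simp add: field_simps)
qed

lemma exists_solution:
  assumes q: "nonneg_sesquilinear q" "bounded_bilinear q" and S: "closed_csubspace S"
    and \<gamma>: "\<gamma> > 0" and coercive: "\<And>x. x \<in> S \<Longrightarrow> \<gamma> * (form_norm p x)\<^sup>2 \<le> qform q x"
    and f: "bounded_linear f" "\<And>t x. f (t *\<^sub>C x) = cnj t * f x"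
  shows "\<exists>u\<in>S. \<forall>w\<in>S. q u w = f w"
proof -
  interpret q: nonneg_sesquilinear q by fact
  obtain c where c: "c > 0" "\<And>u. c * norm u \<le> form_norm p u" by (rule norm_lower) blast
  show ?thesis
  proof (rule q.Riesz_on_subspace[OF S q(2) _ _ f])
    show "0 < \<gamma> * c\<^sup>2" using \<gamma> c by simp
    fix x assume "x \<in> S"
    have "(c * norm x)\<^sup>2 \<le> (form_norm p x)\<^sup>2" using c by (intro power_mono) auto
    then have "\<gamma> * (c * norm x)\<^sup>2 \<le> \<gamma> * (form_norm p x)\<^sup>2" using \<gamma> by simp
    then show "\<gamma> * c\<^sup>2 * (norm x)\<^sup>2 \<le> qform q x"
      using coercive[OF \<open>x \<in> S\<close>] by (simp add: power_mult_distrib algebra_simps)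
  qed
qed

lemma orthogonal_projection:
  assumes "closed_csubspace S"
  obtains v where "v \<in> S" "\<And>w. w \<in> S \<Longrightarrow> p (u - v) w = 0"
proof -
  interpret pb: bounded_bilinear p by (rule bounded_bilinear)
  have "\<exists>v\<in>S. \<forall>w\<in>S. p v w = p u w"
    by (rule exists_solution[of _ _ 1])
      (auto simp: assms bounded_bilinear nonneg_sesquilinear_axioms form_norm_square
        pb.bounded_linear_right scaleC_right)
  then show ?thesis using that by (auto simp: diff_left)
qed

lemma form_norm_orthogonal:
  assumes "p x y = 0"
  shows "form_norm p x \<le> form_norm p (x + y)" "form_norm p y \<le> form_norm p (x + y)"
  using assms by (simp_all add: form_norm_def qform_add)

lemma closed_sum:
  assumes A: "closed_csubspace A" and B: "closed_csubspace B" and k: "k > 0"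
    and le: "\<And>x y. x \<in> A \<Longrightarrow> y \<in> B \<Longrightarrow> k * form_norm p x \<le> form_norm p (x + y)"
  shows "closed_csubspace {x + y | x y. x \<in> A \<and> y \<in> B}" (is "closed_csubspace ?T")
proof -
  obtain c where c: "c > 0" "\<And>u. c * norm u \<le> form_norm p u" by (rule norm_lower) blast
  obtain C where C: "C > 0" "\<And>u. form_norm p u \<le> C * norm u" by (rule norm_upper) (rule that)
  have csA: "csubspace A" and csB: "csubspace B" and clA: "closed A" and clB: "closed B"
    using A B by (auto simp: closed_csubspace_def)
  have "csubspace ?T"
    unfolding csubspace_def
  proof (intro conjI ballI allI)
    have "0 = 0 + (0::'h)" "(0::'h) \<in> A" "(0::'h) \<in> B"
      using csA csB by (simp_all add: csubspace_def)
    then show "0 \<in> ?T" by blast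
  next
    fix x y assume "x \<in> ?T" "y \<in> ?T"
    then obtain x1 x2 y1 y2 where "x = x1 + x2" "y = y1 + y2" "x1 \<in> A" "y1 \<in> A" "x2 \<in> B" "y2 \<in> B"
      by blast
    then have "x + y = (x1 + y1) + (x2 + y2)" "x1 + y1 \<in> A" "x2 + y2 \<in> B"
      using csA csB by (auto simp: csubspace_def)
    then show "x + y \<in> ?T" by blast
  next
    fix t x assume "x \<in> ?T"
    then obtain x1 x2 where "x = x1 + x2" "x1 \<in> A" "x2 \<in> B" by blast
    then have "t *\<^sub>C x = t *\<^sub>C x1 + t *\<^sub>C x2" "t *\<^sub>C x1 \<in> A" "t *\<^sub>C x2 \<in> B"
      using csA csB by (auto simp: csubspace_def scaleC_add_right)
    then show "t *\<^sub>C x \<in> ?T" by blast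
  qed
  moreover have "closed ?T"
    unfolding closed_sequential_limits
  proof (intro allI impI, elim conjE)
    fix t l assume "\<forall>n. t n \<in> ?T" and l: "t \<longlonglongrightarrow> l"
    then have "\<forall>n. \<exists>x y. t n = x + y \<and> x \<in> A \<and> y \<in> B" by blast
    then obtain x y where xy: "\<And>n. t n = x n + y n" "\<And>n. x n \<in> A" "\<And>n. y n \<in> B" by metis
    have "Cauchy t" using l LIMSEQ_imp_Cauchy by blast
    have "Cauchy x"
    proof (rule metric_CauchyI)
      fix e :: real assume e: "0 < e"
      then have "0 < k * c * e / C" using k c C by simp
      then obtain M where M: "\<And>m n. M \<le> m \<Longrightarrow> M \<le> n \<Longrightarrow> dist (t m) (t n) < k * c * e / C"
        using \<open>Cauchy t\<close> metric_CauchyD by blast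
      show "\<exists>M. \<forall>m\<ge>M. \<forall>n\<ge>M. dist (x m) (x n) < e"
      proof (intro exI[of _ M] allI impI)
        fix m n assume mn: "M \<le> m" "M \<le> n"
        have "k * (c * norm (x m - x n)) \<le> k * form_norm p (x m - x n)"
          using k c by simp
        also have "\<dots> \<le> form_norm p ((x m - x n) + (y m - y n))"
          by (intro le csubspace_diff csA csB xy)
        also have "\<dots> = form_norm p (t m - t n)" by (simp add: xy algebra_simps)
        also have "\<dots> \<le> C * norm (t m - t n)" by (rule C)
        also have "\<dots> < C * (k * c * e / C)"
          using M[OF mn] C(1) by (intro mult_strict_left_mono) (auto simp: dist_norm)
        also have "\<dots> = k * (c * e)" using C(1) by simp
        finally show "dist (x m) (x n) < e" using k c(1) by (simp add: dist_norm)
      qed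
    qed
    then obtain x0 where x0: "x \<longlonglongrightarrow> x0" using Cauchy_convergent convergent_def by blast
    have "x0 \<in> A" using closed_sequentially[OF clA xy(2) x0] .
    moreover have "(\<lambda>n. t n - x n) \<longlonglongrightarrow> l - x0" by (intro tendsto_diff l x0)
    then have "y \<longlonglongrightarrow> l - x0" by (simp add: xy)
    then have "l - x0 \<in> B" by (rule closed_sequentially[OF clB xy(3)])
    moreover have "l = x0 + (l - x0)" by simp
    ultimately show "l \<in> ?T" by blast
  qed
  ultimately show ?thesis by (simp add: closed_csubspace_def)
qed

lemma closed_subspace_eq_UNIV:
  assumes T: "closed_csubspace T" and k: "0 < k" "k < 1"
    and near: "\<And>y. \<exists>t\<in>T. form_norm p (y - t) \<le> k * form_norm p y"
  shows "T = UNIV"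
proof (intro equalityI subset_UNIV subsetI)
  fix y
  obtain c where c: "c > 0" "\<And>u. c * norm u \<le> form_norm p u" by (rule norm_lower) blast
  have cs: "csubspace T" and cl: "closed T" using T by (auto simp: closed_csubspace_def)
  have T0: "0 \<in> T" using cs by (auto simp: csubspace_def)
  define d where "d = (INF t\<in>T. form_norm p (y - t))"
  have bdd: "bdd_below ((\<lambda>t. form_norm p (y - t)) ` T)" by (auto intro!: bdd_belowI[of _ 0])
  have d_le: "d \<le> form_norm p (y - t)" if "t \<in> T" for t
    unfolding d_def using bdd that by (rule cINF_lower)
  have lt: "\<exists>t\<in>T. form_norm p (y - t) < e" if "d < e" for e
    using cInf_lessD[of "(\<lambda>t. form_norm p (y - t)) ` T" e] T0 that by (auto simp: d_def)
  have "d \<le> 0"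
  proof (rule ccontr)
    assume "\<not> d \<le> 0"
    then have "d < d / k" using k by (simp add: field_simps)
    then obtain t where t: "t \<in> T" "form_norm p (y - t) < d / k" using lt by blast
    obtain t' where t': "t' \<in> T" "form_norm p (y - t - t') \<le> k * form_norm p (y - t)"
      using near by blast
    have "d \<le> form_norm p (y - (t + t'))"
      using t t' cs by (intro d_le) (auto simp: csubspace_def)
    also have "\<dots> \<le> k * form_norm p (y - t)" using t' by (simp add: diff_diff_eq)
    also have "\<dots> < k * (d / k)" using t k by (intro mult_strict_left_mono) auto
    also have "\<dots> = d" using k by simp
    finally show False by simp
  qed
  have "y \<in> closure T"
    unfolding closure_approachable
  proof (intro allI impI)
    fix e :: real assume "0 < e"
    then have "d < c * e" using \<open>d \<le> 0\<close> mult_pos_pos[OF c(1), of e] by linarith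
    then obtain t where t: "t \<in> T" "form_norm p (y - t) < c * e" using lt by blast
    have "c * norm (y - t) < c * e" using t c(2) order_le_less_trans by blast
    then show "\<exists>t\<in>T. dist t y < e" using t c(1) by (auto simp: dist_norm norm_minus_commute)
  qed
  then show "y \<in> T" using cl by simp
qed

lemma angle_bound:
  assumes k: "0 \<le> k" "k < 1" and xy: "cmod (p x y) \<le> k * form_norm p x * form_norm p y"
  shows "(1 - k) * form_norm p x \<le> form_norm p (x + y)"
proof (rule power2_le_imp_le)
  define X Y where "X = form_norm p x" and "Y = form_norm p y"
  have "0 \<le> (Y - k * X)\<^sup>2 + 2 * k * (1 - k) * X\<^sup>2" using k by simp
  moreover have "Re (p x y) \<ge> - (k * X * Y)"
    using xy abs_Re_le_cmod[of "p x y"] by (simp add: X_def Y_def)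
  ultimately have "((1 - k) * X)\<^sup>2 \<le> X\<^sup>2 + 2 * Re (p x y) + Y\<^sup>2"
    by (simp add: power2_eq_square algebra_simps)
  then show "((1 - k) * form_norm p x)\<^sup>2 \<le> (form_norm p (x + y))\<^sup>2"
    unfolding form_norm_square qform_add by (simp add: X_def Y_def form_norm_square)
qed simp

lemma complement_perturbation:
  assumes B: "closed_csubspace B" and X: "closed_csubspace X"
    and k: "0 \<le> k" "k < 1" and AX: "\<And>u. \<exists>x\<in>A. \<exists>y\<in>X. u = x + y"
    and angle: "\<And>x y. x \<in> A \<Longrightarrow> y \<in> X \<Longrightarrow> cmod (p x y) \<le> k * form_norm p x * form_norm p y"
    and AB: "\<And>x. x \<in> A \<Longrightarrow> \<exists>y\<in>B. form_norm p (x - y) \<le> (1 - k) / 3 * form_norm p x"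
    and BA: "\<And>x. x \<in> B \<Longrightarrow> \<exists>y\<in>A. form_norm p (x - y) \<le> (1 - k) / 3 * form_norm p x"
  shows "\<exists>x\<in>B. \<exists>y\<in>X. u = x + y" and "B \<inter> X = {0}"
proof -
  have lower: "(1 - k) / 3 * form_norm p x \<le> form_norm p (x + y)" if xB: "x \<in> B" and yX: "y \<in> X" for x y
  proof -
    obtain v where v: "v \<in> A" "form_norm p (x - v) \<le> (1 - k) / 3 * form_norm p x"
      using BA xB by blast
    have "form_norm p x \<le> form_norm p v + form_norm p (x - v)"
      using form_norm_triangle[of v "x - v"] by simp
    then have "(1 - (1 - k) / 3) * form_norm p x \<le> form_norm p v"
      using v(2) unfolding left_diff_distrib[of 1 "(1 - k) / 3"] by linarith
    then have "(1 - k) * ((1 - (1 - k) / 3) * form_norm p x) \<le> (1 - k) * form_norm p v"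
      using k by (intro mult_left_mono) auto
    also have "\<dots> \<le> form_norm p (v + y)"
      using angle_bound[OF k angle] v yX by blast
    also have "\<dots> \<le> form_norm p (x + y) + form_norm p (x - v)"
      using form_norm_triangle[of "x + y" "v - x"] form_norm_minus_commute[of x v]
      by (simp add: add.commute)
    finally have "(1 - k) * ((1 - (1 - k) / 3) * form_norm p x) - (1 - k) / 3 * form_norm p x
      \<le> form_norm p (x + y)" using v(2) by simp
    moreover have "(1 - k) / 3 * form_norm p x + k * (1 - k) / 3 * form_norm p x =
      (1 - k) * ((1 - (1 - k) / 3) * form_norm p x) - (1 - k) / 3 * form_norm p x"
      by (simp add: field_simps)
    moreover have "0 \<le> k * (1 - k) / 3 * form_norm p x" using k by simp
    ultimately show ?thesis by linarith
  qed
  have "{x + y | x y. x \<in> B \<and> y \<in> X} = UNIV" (is "?T = _")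
  proof (rule closed_subspace_eq_UNIV[of _ "1/3"])
    show "closed_csubspace ?T" using k by (intro closed_sum[OF B X _ lower]) auto
    fix u
    obtain x y where xy: "x \<in> A" "y \<in> X" "u = x + y" using AX by blast
    obtain x' where x': "x' \<in> B" "form_norm p (x - x') \<le> (1 - k) / 3 * form_norm p x"
      using AB xy by blast
    have "(1 - k) * form_norm p x \<le> form_norm p u"
      using angle_bound[OF k angle] xy by blast
    then have "form_norm p (u - (x' + y)) \<le> 1/3 * form_norm p u"
      using x' xy by simp
    then show "\<exists>t\<in>?T. form_norm p (u - t) \<le> 1/3 * form_norm p u"
      using x' xy by blast
  qed auto
  then have "u \<in> {x + y | x y. x \<in> B \<and> y \<in> X}" by blast
  then show "\<exists>x\<in>B. \<exists>y\<in>X. u = x + y" by blast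
  have "x = 0" if "x \<in> B" "x \<in> X" for x
  proof -
    have "- x \<in> X" using that X scaleC_minus1[of x]
      by (metis closed_csubspace_def csubspace_def)
    from lower[OF that(1) this] have "form_norm p x \<le> 0"
      using k by (simp add: form_norm_def[of p 0] mult_le_0_iff)
    then show "x = 0" using form_norm_pos_iff[of x] by linarith
  qed
  moreover have "0 \<in> B" "0 \<in> X" using B X by (auto simp: closed_csubspace_def csubspace_def)
  ultimately show "B \<inter> X = {0}" by blast
qed

end

section \<open>Abstract error estimates\<close>

locale form_pair = \<alpha>: nonneg_sesquilinear \<alpha> + \<beta>: nonneg_sesquilinear \<beta>
  for \<alpha> \<beta> :: "'h::chilbert_space form" +
  assumes sum_equivalent: "equivalent_to_norm (form_sum \<alpha> \<beta>)"
begin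

sublocale sum: equivalent_inner_product "form_sum \<alpha> \<beta>"
proof
  show "sesquilinear (form_sum \<alpha> \<beta>)"
    using \<alpha>.sesquilinear \<beta>.sesquilinear
    by (simp add: sesquilinear_def form_sum_def algebra_simps)
  show "nonneg_form (form_sum \<alpha> \<beta>)"
    using \<alpha>.nonneg \<beta>.nonneg by (simp add: nonneg_form_def form_sum_def)
qed (rule sum_equivalent)

lemma qform_sum: "qform (form_sum \<alpha> \<beta>) u = qform \<alpha> u + qform \<beta> u"
  by (simp add: qform_def form_sum_def)

lemma qform_right_le: "qform \<beta> u \<le> (form_norm (form_sum \<alpha> \<beta>) u)\<^sup>2"
  by (simp add: sum.form_norm_square qform_sum)

lemma form_norm_le: "form_norm \<alpha> u \<le> form_norm (form_sum \<alpha> \<beta>) u"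
  "form_norm \<beta> u \<le> form_norm (form_sum \<alpha> \<beta>) u"
  by (simp_all add: form_norm_def qform_sum)

lemma bounded_bilinear_left: "bounded_bilinear \<alpha>"
  and bounded_bilinear_right: "bounded_bilinear \<beta>"
proof -
  obtain C where C: "\<And>u. form_norm (form_sum \<alpha> \<beta>) u \<le> C * norm u" by (rule sum.norm_upper) blast
  show "bounded_bilinear \<alpha>" "bounded_bilinear \<beta>"
    using form_norm_le C order_trans
    by (blast intro: \<alpha>.bounded_bilinearI \<beta>.bounded_bilinearI)+
qed

abbreviation "V \<equiv> {v. qform \<alpha> v = 0}"

abbreviation "W \<equiv> {w. \<forall>v\<in>V. form_sum \<alpha> \<beta> w v = 0}"

lemma closed_csubspace_annihilator:
  assumes "nonneg_sesquilinear q" "bounded_bilinear q"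
  shows "closed_csubspace {u. \<forall>w\<in>S. q u w = 0}"
proof -
  interpret q: nonneg_sesquilinear q by fact
  interpret qb: bounded_bilinear q by fact
  have "closed {u. q u w = 0}" for w
    by (intro closed_Collect_eq qb.continuous_on continuous_intros)
  then have "closed (\<Inter>w\<in>S. {u. q u w = 0})" by (intro closed_INT ballI)
  moreover have "(\<Inter>w\<in>S. {u. q u w = 0}) = {u. \<forall>w\<in>S. q u w = 0}" by auto
  ultimately show ?thesis
    by (auto simp: closed_csubspace_def csubspace_def q.add_left q.scaleC_left)
qed

lemma closed_V: "closed_csubspace V"
proof -
  have "V = {u. \<forall>w\<in>UNIV. \<alpha> u w = 0}" by (simp add: \<alpha>.qform_zero_iff)
  with closed_csubspace_annihilator[OF \<alpha>.nonneg_sesquilinear_axioms bounded_bilinear_left]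
  show ?thesis by presburger
qed

lemma closed_W: "closed_csubspace W"
  by (rule closed_csubspace_annihilator[OF sum.nonneg_sesquilinear_axioms sum.bounded_bilinear])

lemma V_orthogonal_W: "v \<in> V \<Longrightarrow> w \<in> W \<Longrightarrow> form_sum \<alpha> \<beta> v w = 0"
  using sum.hermitian[of w v] by simp

lemma V_decomposition:
  obtains v w where "v \<in> V" "w \<in> W" "u = v + w"
proof -
  obtain v where v: "v \<in> V" "\<And>w. w \<in> V \<Longrightarrow> form_sum \<alpha> \<beta> (u - v) w = 0"
    by (rule sum.orthogonal_projection[OF closed_V]) blast
  show ?thesis by (rule that[of v "u - v"]) (use v in auto)
qed

lemma V_inter_W: "u \<in> V \<Longrightarrow> u \<in> W \<Longrightarrow> u = 0"
  using V_orthogonal_W[of u u] sum.qform_eq_0_iff[of u] by (simp add: qform_def)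

definition scaled_sum :: "real \<Rightarrow> 'h form" where
  "scaled_sum \<epsilon> u w = complex_of_real (1 / \<epsilon>\<^sup>2) * \<alpha> u w + \<beta> u w"

lemma nonneg_sesquilinear_scaled_sum: "nonneg_sesquilinear (scaled_sum \<epsilon>)"
proof
  show "sesquilinear (scaled_sum \<epsilon>)"
    using \<alpha>.sesquilinear \<beta>.sesquilinear
    by (simp add: sesquilinear_def scaled_sum_def algebra_simps add_divide_distrib)
  show "nonneg_form (scaled_sum \<epsilon>)"
    using \<alpha>.nonneg \<beta>.nonneg
    by (simp add: nonneg_form_def scaled_sum_def \<alpha>.self_eq \<beta>.self_eq)
qed

lemma qform_scaled_sum: "qform (scaled_sum \<epsilon>) u = qform \<alpha> u / \<epsilon>\<^sup>2 + qform \<beta> u"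
  unfolding qform_def scaled_sum_def plus_complex.sel times_complex.sel Re_complex_of_real
    Im_complex_of_real by simp

lemma bounded_bilinear_scaled_sum: "bounded_bilinear (scaled_sum \<epsilon>)"
proof -
  interpret E: nonneg_sesquilinear "scaled_sum \<epsilon>" by (rule nonneg_sesquilinear_scaled_sum)
  obtain C where C: "C > 0" "\<And>u. form_norm (form_sum \<alpha> \<beta>) u \<le> C * norm u"
    by (rule sum.norm_upper) blast
  show ?thesis
  proof (rule E.bounded_bilinearI)
    fix u
    have "qform (scaled_sum \<epsilon>) u \<le> (1 / \<epsilon>\<^sup>2 + 1) * qform (form_sum \<alpha> \<beta>) u"
      by (simp add: qform_scaled_sum qform_sum distrib_left distrib_right)
    then have "form_norm (scaled_sum \<epsilon>) u \<le> sqrt (1 / \<epsilon>\<^sup>2 + 1) * form_norm (form_sum \<alpha> \<beta>) u"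
      unfolding form_norm_def real_sqrt_mult[symmetric] by (rule real_sqrt_le_mono)
    also have "\<dots> \<le> sqrt (1 / \<epsilon>\<^sup>2 + 1) * (C * norm u)"
      by (intro mult_left_mono C) simp
    finally show "form_norm (scaled_sum \<epsilon>) u \<le> sqrt (1 / \<epsilon>\<^sup>2 + 1) * C * norm u"
      by (simp add: mult.assoc)
  qed
qed

lemma qform_scaled_sum_ge:
  assumes "0 < \<epsilon>" "\<epsilon> < 1"
  shows "(form_norm (form_sum \<alpha> \<beta>) u)\<^sup>2 \<le> qform (scaled_sum \<epsilon>) u"
proof -
  have "\<epsilon>\<^sup>2 \<le> 1" using assms by (simp add: power_le_one)
  then have "qform \<alpha> u \<le> qform \<alpha> u / \<epsilon>\<^sup>2"
    using assms mult_left_mono[OF _ \<alpha>.qform_nonneg, of "\<epsilon>\<^sup>2" 1 u] by (simp add: le_divide_eq)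
  then show ?thesis by (simp add: sum.form_norm_square qform_sum qform_scaled_sum)
qed

lemma scaled_sum_solution:
  assumes "0 < \<epsilon>" "\<epsilon> < 1" "f \<in> antidual" "closed_csubspace S"
  shows "\<exists>!u. u \<in> S \<and> (\<forall>w\<in>S. scaled_sum \<epsilon> u w = f w)"
proof -
  interpret E: nonneg_sesquilinear "scaled_sum \<epsilon>" by (rule nonneg_sesquilinear_scaled_sum)
  have "\<exists>u\<in>S. \<forall>w\<in>S. scaled_sum \<epsilon> u w = f w"
    using assms antidual_bounded_linear[OF assms(3)] qform_scaled_sum_ge
    by (intro sum.exists_solution[of _ _ 1] nonneg_sesquilinear_scaled_sum
        bounded_bilinear_scaled_sum) auto
  moreover have "u = u'" if "u \<in> S \<and> (\<forall>w\<in>S. scaled_sum \<epsilon> u w = f w)"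
    "u' \<in> S \<and> (\<forall>w\<in>S. scaled_sum \<epsilon> u' w = f w)" for u u'
  proof (rule E.solution_unique[of S])
    fix x assume "qform (scaled_sum \<epsilon>) x = 0"
    with qform_scaled_sum_ge[OF assms(1,2), of x] show "x = 0" by simp
  qed (use that assms(4) in \<open>auto simp: closed_csubspace_def\<close>)
  ultimately show ?thesis by blast
qed

lemma V_solution:
  assumes "f \<in> antidual"
  shows "\<exists>!v. v \<in> V \<and> (\<forall>w\<in>V. \<beta> v w = f w)"
proof -
  have q: "qform \<beta> x = (form_norm (form_sum \<alpha> \<beta>) x)\<^sup>2" if "x \<in> V" for x
    using that by (simp add: sum.form_norm_square qform_sum)
  have "\<exists>u\<in>V. \<forall>w\<in>V. \<beta> u w = f w"
    using assms antidual_bounded_linear[OF assms] q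
    by (intro sum.exists_solution[of _ _ 1] \<beta>.nonneg_sesquilinear_axioms
        bounded_bilinear_right closed_V) auto
  moreover have "u = u'" if "u \<in> V \<and> (\<forall>w\<in>V. \<beta> u w = f w)" "u' \<in> V \<and> (\<forall>w\<in>V. \<beta> u' w = f w)" for u u'
    by (rule \<beta>.solution_unique[of V])
      (use that closed_V q in \<open>auto simp: closed_csubspace_def\<close>)
  ultimately show ?thesis by blast
qed

text \<open>Far from the singularity the error is the component of the solution in \<open>W\<close>.\<close>

lemma gap_error_estimate:
  assumes \<epsilon>: "0 < \<epsilon>" "\<epsilon> < 1"
    and \<gamma>: "\<gamma> > 0" and gap: "\<And>w. w \<in> W \<Longrightarrow> \<gamma> * (form_norm (form_sum \<alpha> \<beta>) w)\<^sup>2 \<le> qform \<alpha> w"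
    and f: "f \<in> antidual"
    and fD: "\<And>u. cmod (f u) \<le> D * form_norm (form_sum \<alpha> \<beta>) u" and D: "0 \<le> D"
    and u: "\<And>w. scaled_sum \<epsilon> u w = f w"
    and v: "v \<in> V" "\<And>w. w \<in> V \<Longrightarrow> \<beta> v w = f w"
  shows "qform (scaled_sum \<epsilon>) (u - v) \<le> 1 / \<gamma> * (\<epsilon>\<^sup>2 * D\<^sup>2)"
    and "qform \<beta> (u - v) \<le> 1 / \<gamma>\<^sup>2 * (\<epsilon> ^ 4 * D\<^sup>2)"
proof -
  let ?N = "form_norm (form_sum \<alpha> \<beta>)"
  interpret E: nonneg_sesquilinear "scaled_sum \<epsilon>" by (rule nonneg_sesquilinear_scaled_sum)
  obtain v' w where vw: "v' \<in> V" "w \<in> W" "u = v' + w" by (rule V_decomposition)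
  have "\<beta> v' x = f x" if x: "x \<in> V" for x
  proof -
    have "\<alpha> y x = 0" for y using x by (simp add: \<alpha>.qform_zero_imp_right)
    moreover have "\<alpha> w x + \<beta> w x = 0" using vw(2) x by (simp add: form_sum_def)
    ultimately show ?thesis using u[of x] vw(3) by (simp add: scaled_sum_def \<beta>.add_left)
  qed
  then have "v' = v" using V_solution[OF f] vw(1) v by blast
  then have uv: "u - v = w" using vw by simp
  have "scaled_sum \<epsilon> v w = 0"
  proof -
    have "\<alpha> v w = 0" using v(1) by (simp add: \<alpha>.qform_zero_imp_left)
    moreover have "\<alpha> v w + \<beta> v w = 0"
      using V_orthogonal_W[OF v(1) vw(2)] by (simp add: form_sum_def)
    ultimately show ?thesis by (simp add: scaled_sum_def)
  qed
  then have "scaled_sum \<epsilon> w w = f w"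
    using u[of w] by (simp add: uv[symmetric] E.diff_left)
  then have q_le: "qform (scaled_sum \<epsilon>) w \<le> D * ?N w"
    unfolding qform_def using order_trans[OF complex_Re_le_cmod fD] by metis
  define q where "q = qform (scaled_sum \<epsilon>) w"
  have \<alpha>_le: "qform \<alpha> w \<le> \<epsilon>\<^sup>2 * q"
    using \<epsilon> by (simp add: q_def qform_scaled_sum field_simps)
  have N_le: "(?N w)\<^sup>2 \<le> \<epsilon>\<^sup>2 * q / \<gamma>"
    using gap[OF vw(2)] \<alpha>_le \<gamma> by (simp add: field_simps)
  have q0: "0 \<le> q" by (simp add: q_def)
  have q: "q \<le> 1 / \<gamma> * (\<epsilon>\<^sup>2 * D\<^sup>2)"
  proof (rule square_le_mult_imp_le)
    have "q\<^sup>2 \<le> (D * ?N w)\<^sup>2" using q_le q0 unfolding q_def by (intro power_mono) auto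
    also have "\<dots> \<le> D\<^sup>2 * (\<epsilon>\<^sup>2 * q / \<gamma>)"
      unfolding power_mult_distrib using N_le by (intro mult_left_mono) auto
    also have "\<dots> = q * (1 / \<gamma> * (\<epsilon>\<^sup>2 * D\<^sup>2))" by simp
    finally show "q\<^sup>2 \<le> q * (1 / \<gamma> * (\<epsilon>\<^sup>2 * D\<^sup>2))" .
  qed (use q0 \<gamma> in simp_all)
  then show "qform (scaled_sum \<epsilon>) (u - v) \<le> 1 / \<gamma> * (\<epsilon>\<^sup>2 * D\<^sup>2)"
    by (simp add: uv q_def)
  have "qform \<beta> w \<le> \<epsilon>\<^sup>2 / \<gamma> * q"
    using qform_right_le[of w] N_le by simp
  also have "\<dots> \<le> \<epsilon>\<^sup>2 / \<gamma> * (1 / \<gamma> * (\<epsilon>\<^sup>2 * D\<^sup>2))"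
    using q \<gamma> by (intro mult_left_mono) auto
  also have "\<dots> = 1 / \<gamma>\<^sup>2 * (\<epsilon> ^ 4 * D\<^sup>2)"
    by (simp add: power2_eq_square power4_eq_xxxx)
  finally show "qform \<beta> (u - v) \<le> 1 / \<gamma>\<^sup>2 * (\<epsilon> ^ 4 * D\<^sup>2)" by (simp add: uv)
qed

text \<open>
  Galerkin approximation on the \<open>\<alpha>\<close>-orthogonal complement of a subspace \<open>X\<close> on which \<open>\<alpha>\<close> is
  coercive. The error is split \<open>\<alpha>\<close>-orthogonally as \<open>s + x\<close>; testing with \<open>s\<close> shows
  \<open>\<beta>(e, s) \<le> 0\<close>, so that \<open>\<beta>[e] \<le> \<beta>[x]\<close> gains the additional factor \<open>\<epsilon>\<^sup>2\<close>.
\<close>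

lemma Galerkin_error_estimate:
  assumes \<epsilon>: "0 < \<epsilon>" "\<epsilon> < 1"
    and X: "closed_csubspace X"
    and \<gamma>: "\<gamma> > 0" and coercive: "\<And>x. x \<in> X \<Longrightarrow> \<gamma> * (form_norm (form_sum \<alpha> \<beta>) x)\<^sup>2 \<le> qform \<alpha> x"
    and fD: "\<And>u. cmod (f u) \<le> D * form_norm (form_sum \<alpha> \<beta>) u" and D: "0 \<le> D"
    and u: "\<And>w. scaled_sum \<epsilon> u w = f w"
    and S: "S = {u. \<forall>w\<in>X. \<alpha> u w = 0}"
    and u0: "u0 \<in> S" "\<And>s. s \<in> S \<Longrightarrow> scaled_sum \<epsilon> u0 s = f s"
  shows "qform (scaled_sum \<epsilon>) (u - u0) \<le> 4 / \<gamma> * (\<epsilon>\<^sup>2 * D\<^sup>2)"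
    and "qform \<beta> (u - u0) \<le> 4 / \<gamma>\<^sup>2 * (\<epsilon> ^ 4 * D\<^sup>2)"
proof -
  let ?N = "form_norm (form_sum \<alpha> \<beta>)"
  interpret E: nonneg_sesquilinear "scaled_sum \<epsilon>" by (rule nonneg_sesquilinear_scaled_sum)
  interpret \<alpha>b: bounded_bilinear \<alpha> by (rule bounded_bilinear_left)
  define e where "e = u - u0"
  have "\<exists>x\<in>X. \<forall>w\<in>X. \<alpha> x w = \<alpha> e w"
    by (rule sum.exists_solution[OF \<alpha>.nonneg_sesquilinear_axioms bounded_bilinear_left X \<gamma>
          coercive \<alpha>b.bounded_linear_right \<alpha>.scaleC_right])
  then obtain x where x: "x \<in> X" "\<And>w. w \<in> X \<Longrightarrow> \<alpha> x w = \<alpha> e w" by blast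
  define s where "s = e - x"
  have s: "s \<in> S" unfolding S s_def using x(2) by (simp add: \<alpha>.diff_left)
  have e_eq: "e = s + x" by (simp add: s_def)
  have "\<alpha> s x = 0" "\<alpha> u0 x = 0" using s u0(1) x(1) unfolding S by blast+
  then have "\<alpha> x s = 0" using \<alpha>.hermitian[of s x] by simp
  have orth: "scaled_sum \<epsilon> e s = 0" by (simp add: e_def E.diff_left u u0(2)[OF s])
  have "(?N u0)\<^sup>2 \<le> qform (scaled_sum \<epsilon>) u0" by (rule qform_scaled_sum_ge[OF \<epsilon>])
  also have "\<dots> = Re (f u0)" unfolding qform_def u0(2)[OF u0(1)] ..
  also have "\<dots> \<le> cmod (f u0)" by (rule complex_Re_le_cmod)
  also have "\<dots> \<le> ?N u0 * D" using fD[of u0] by (simp only: mult.commute)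
  finally have "?N u0 \<le> D" by (rule square_le_mult_imp_le) (simp_all add: D)
  have "cmod (\<beta> u0 x) \<le> form_norm \<beta> u0 * form_norm \<beta> x" by (rule \<beta>.Cauchy_Schwarz)
  also have "\<dots> \<le> D * ?N x"
    using form_norm_le(2)[of u0] form_norm_le(2)[of x] \<open>?N u0 \<le> D\<close> D by (intro mult_mono) auto
  finally have \<beta>_le: "cmod (\<beta> u0 x) \<le> D * ?N x" .
  have "scaled_sum \<epsilon> e e = scaled_sum \<epsilon> e x"
    using orth by (subst (2) e_eq) (simp add: E.add_right)
  also have "\<dots> = f x - \<beta> u0 x"
    by (simp add: e_def E.diff_left u) (simp add: scaled_sum_def \<open>\<alpha> u0 x = 0\<close>)
  finally have "qform (scaled_sum \<epsilon>) e = Re (f x - \<beta> u0 x)" by (simp add: qform_def)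
  also have "\<dots> \<le> cmod (f x) + cmod (\<beta> u0 x)"
    by (rule order_trans[OF complex_Re_le_cmod norm_triangle_ineq4])
  also have "\<dots> \<le> 2 * D * ?N x" using fD[of x] \<beta>_le by simp
  finally have q_le: "qform (scaled_sum \<epsilon>) e \<le> 2 * D * ?N x" .
  define q where "q = qform (scaled_sum \<epsilon>) e"
  have q0: "0 \<le> q" by (simp add: q_def)
  have "qform \<alpha> x \<le> qform \<alpha> e"
    by (simp add: e_eq \<alpha>.qform_add \<open>\<alpha> s x = 0\<close>)
  also have "qform \<alpha> e \<le> \<epsilon>\<^sup>2 * q"
    using \<epsilon> by (simp add: q_def qform_scaled_sum field_simps)
  finally have N_le: "(?N x)\<^sup>2 \<le> \<epsilon>\<^sup>2 * q / \<gamma>"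
    using coercive[OF x(1)] \<gamma> by (simp add: field_simps)
  have q: "q \<le> 4 / \<gamma> * (\<epsilon>\<^sup>2 * D\<^sup>2)"
  proof (rule square_le_mult_imp_le)
    have "q\<^sup>2 \<le> (2 * D * ?N x)\<^sup>2" using q_le q0 unfolding q_def by (intro power_mono) auto
    also have "\<dots> \<le> (2 * D)\<^sup>2 * (\<epsilon>\<^sup>2 * q / \<gamma>)"
      unfolding power_mult_distrib[of "2 * D"] using N_le by (intro mult_left_mono) auto
    also have "\<dots> = q * (4 / \<gamma> * (\<epsilon>\<^sup>2 * D\<^sup>2))" by (simp add: power2_eq_square)
    finally show "q\<^sup>2 \<le> q * (4 / \<gamma> * (\<epsilon>\<^sup>2 * D\<^sup>2))" .
  qed (use q0 \<gamma> in simp_all)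
  then show "qform (scaled_sum \<epsilon>) (u - u0) \<le> 4 / \<gamma> * (\<epsilon>\<^sup>2 * D\<^sup>2)"
    by (simp add: e_def q_def)
  have "qform \<beta> e \<le> qform \<beta> x"
  proof -
    have "Re (\<beta> e s) = - qform \<alpha> s / \<epsilon>\<^sup>2"
      using orth \<open>\<alpha> x s = 0\<close>
      by (simp add: scaled_sum_def e_eq \<alpha>.add_left \<alpha>.self_eq add_eq_0_iff)
    also have "\<dots> \<le> 0" using \<epsilon> by simp
    also have "Re (\<beta> e s) = qform \<beta> s + Re (\<beta> s x)"
      using \<beta>.hermitian[of s x] by (simp add: e_eq \<beta>.add_left qform_def)
    finally have "qform \<beta> s + Re (\<beta> s x) \<le> 0" .
    moreover have "qform \<beta> e = qform \<beta> s + 2 * Re (\<beta> s x) + qform \<beta> x"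
      by (simp add: e_eq \<beta>.qform_add)
    ultimately show ?thesis using \<beta>.qform_nonneg[of s] by linarith
  qed
  also have "\<dots> \<le> \<epsilon>\<^sup>2 / \<gamma> * q"
    using qform_right_le[of x] N_le by simp
  also have "\<dots> \<le> \<epsilon>\<^sup>2 / \<gamma> * (4 / \<gamma> * (\<epsilon>\<^sup>2 * D\<^sup>2))"
    using q \<gamma> by (intro mult_left_mono) auto
  also have "\<dots> = 4 / \<gamma>\<^sup>2 * (\<epsilon> ^ 4 * D\<^sup>2)"
    by (simp add: power2_eq_square power4_eq_xxxx)
  finally show "qform \<beta> (u - u0) \<le> 4 / \<gamma>\<^sup>2 * (\<epsilon> ^ 4 * D\<^sup>2)" by (simp add: e_def)
qed

end

section \<open>Families with a removable singularity\<close>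

locale gapped_family =
  fixes \<Theta> :: "(real ^ 'n::finite) set"
    and a b :: "('n, 'h::chilbert_space) form_family"
    and K La :: real
  assumes standing: "standing_assumptions \<Theta> a b K La"
    and gap: "spectral_gap \<Theta> a b"
begin

lemma K_pos: "0 < K" and La_pos: "0 < La" and compact: "compact \<Theta>"
  using standing unfolding standing_assumptions_def by blast+

lemma tnorm_le: "\<theta>1 \<in> \<Theta> \<Longrightarrow> \<theta>2 \<in> \<Theta> \<Longrightarrow> tnorm a b \<theta>1 u \<le> K * tnorm a b \<theta>2 u"
  using standing unfolding standing_assumptions_def by blast

lemma a_Lipschitz: "\<theta>1 \<in> \<Theta> \<Longrightarrow> \<theta>2 \<in> \<Theta> \<Longrightarrow>
  cmod (a \<theta>1 u w - a \<theta>2 u w) \<le> La * norm (\<theta>1 - \<theta>2) * tnorm a b \<theta>1 u * tnorm a b \<theta>1 w"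
  using standing unfolding standing_assumptions_def by blast

lemma form_pair:
  assumes "\<theta> \<in> \<Theta>"
  shows "form_pair (a \<theta>) (b \<theta>)"
proof -
  have "sesquilinear (a \<theta>)" "nonneg_form (a \<theta>)" "sesquilinear (b \<theta>)" "nonneg_form (b \<theta>)"
    "equivalent_to_norm (ip a b \<theta>)"
    using standing assms unfolding standing_assumptions_def by blast+
  then show ?thesis
    by (simp add: form_pair_def form_pair_axioms_def nonneg_sesquilinear_def ip_def)
qed

lemma tnorm_eq: "tnorm a b \<theta> = form_norm (form_sum (a \<theta>) (b \<theta>))"
  by (simp add: tnorm_def ip_def)

lemma orthW_eq: "orthW a b \<theta> = {w. \<forall>v\<in>kerV a \<theta>. form_sum (a \<theta>) (b \<theta>) w v = 0}"
  by (simp add: orthW_def ip_def)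

context
  fixes \<theta> assumes \<theta>: "\<theta> \<in> \<Theta>"
begin

interpretation P: form_pair "a \<theta>" "b \<theta>" by (rule form_pair[OF \<theta>])

lemma closed_kerV: "closed_csubspace (kerV a \<theta>)"
  unfolding kerV_def by (rule P.closed_V)

lemma closed_orthW: "closed_csubspace (orthW a b \<theta>)"
  unfolding orthW_eq kerV_def by (rule P.closed_W)

lemma kerV_orthW_decomposition:
  obtains v w where "v \<in> kerV a \<theta>" "w \<in> orthW a b \<theta>" "u = v + w"
  unfolding orthW_eq kerV_def by (rule P.V_decomposition)

lemma kerV_inter_orthW: "u \<in> kerV a \<theta> \<Longrightarrow> u \<in> orthW a b \<theta> \<Longrightarrow> u = 0"
  unfolding orthW_eq kerV_def by (rule P.V_inter_W)

lemma kerV_orthogonal: "v \<in> kerV a \<theta> \<Longrightarrow> w \<in> orthW a b \<theta> \<Longrightarrow> form_sum (a \<theta>) (b \<theta>) v w = 0"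
  unfolding orthW_eq kerV_def by (rule P.V_orthogonal_W)

lemma kerV_left: "v \<in> kerV a \<theta> \<Longrightarrow> a \<theta> v w = 0"
  unfolding kerV_def by (simp add: P.\<alpha>.qform_zero_imp_left)

lemma kerV_right: "v \<in> kerV a \<theta> \<Longrightarrow> a \<theta> w v = 0"
  unfolding kerV_def by (simp add: P.\<alpha>.qform_zero_imp_right)

lemma zero_in_orthW: "0 \<in> orthW a b \<theta>"
  using closed_orthW by (simp add: closed_csubspace_def csubspace_def)

lemma gap_bound_nu: "gap_bound a b \<theta> (nu a b \<theta>)"
  and nu_ge: "gap_bound a b \<theta> c \<Longrightarrow> min 1 c \<le> nu a b \<theta>"
proof -
  have "gap_bound a b \<theta> (nu a b \<theta>) \<and> (gap_bound a b \<theta> c \<longrightarrow> min 1 c \<le> nu a b \<theta>)"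
  proof (cases "orthW a b \<theta> = {0}")
    case True
    then show ?thesis by (simp add: nu_def gap_bound_def tnorm_eq)
  next
    case False
    define G where "G = {c. gap_bound a b \<theta> c}"
    have le: "d \<le> qform (a \<theta>) w / (tnorm a b \<theta> w)\<^sup>2"
      if "d \<in> G" "w \<in> orthW a b \<theta>" "w \<noteq> 0" for d w
    proof -
      have "0 < tnorm a b \<theta> w" using that P.sum.form_norm_pos_iff by (simp add: tnorm_eq)
      moreover have "d * (tnorm a b \<theta> w)\<^sup>2 \<le> qform (a \<theta>) w"
        using that by (simp add: G_def gap_bound_def)
      ultimately show ?thesis by (simp add: pos_le_divide_eq)
    qed
    obtain w where w: "w \<in> orthW a b \<theta>" "w \<noteq> 0" using False zero_in_orthW by blast
    obtain c0 where c0: "gap_bound a b \<theta> c0" using gap \<theta> by (auto simp: spectral_gap_def)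
    have G: "c0 \<in> G" using c0 by (simp add: G_def)
    have bdd: "bdd_above G" using le[OF _ w] by (rule bdd_aboveI)
    have "0 < c0" using c0 by (simp add: gap_bound_def)
    also have "c0 \<le> Sup G" using G bdd by (rule cSup_upper)
    finally have Sup_pos: "0 < Sup G" .
    have "Sup G * (tnorm a b \<theta> x)\<^sup>2 \<le> qform (a \<theta>) x" if x: "x \<in> orthW a b \<theta>" for x
    proof (cases "x = 0")
      case True
      then show ?thesis by (simp add: tnorm_eq)
    next
      case False
      have "Sup G \<le> qform (a \<theta>) x / (tnorm a b \<theta> x)\<^sup>2"
        using G le[OF _ x False] by (intro cSup_least) auto
      moreover have "0 < tnorm a b \<theta> x" using False P.sum.form_norm_pos_iff by (simp add: tnorm_eq)
      ultimately show ?thesis by (simp add: pos_le_divide_eq)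
    qed
    with Sup_pos have Sup: "gap_bound a b \<theta> (Sup G)" by (simp add: gap_bound_def)
    have upper: "d \<le> Sup G" if "gap_bound a b \<theta> d" for d
      using that bdd by (auto simp: G_def intro: cSup_upper)
    have "(GREATEST d. gap_bound a b \<theta> d) = Sup G"
      using Sup upper by (rule Greatest_equality)
    with False have "nu a b \<theta> = Sup G" by (simp add: nu_def)
    then show ?thesis using Sup upper[of c] by auto
  qed
  then show "gap_bound a b \<theta> (nu a b \<theta>)" "gap_bound a b \<theta> c \<Longrightarrow> min 1 c \<le> nu a b \<theta>" by auto
qed

lemma nu_pos: "0 < nu a b \<theta>"
  using gap_bound_nu by (simp add: gap_bound_def)

lemma nu_le: "w \<in> orthW a b \<theta> \<Longrightarrow> nu a b \<theta> * (tnorm a b \<theta> w)\<^sup>2 \<le> qform (a \<theta>) w"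
  using gap_bound_nu by (simp add: gap_bound_def)

end

lemma qform_a_Lipschitz:
  assumes "\<theta>1 \<in> \<Theta>" "\<theta>2 \<in> \<Theta>"
  shows "qform (a \<theta>1) u - La * norm (\<theta>1 - \<theta>2) * (tnorm a b \<theta>1 u)\<^sup>2 \<le> qform (a \<theta>2) u"
proof -
  have "Re (a \<theta>1 u u - a \<theta>2 u u) \<le> La * norm (\<theta>1 - \<theta>2) * (tnorm a b \<theta>1 u)\<^sup>2"
    using order_trans[OF complex_Re_le_cmod a_Lipschitz[OF assms, of u u]]
    by (simp add: power2_eq_square mult.assoc)
  then show ?thesis by (simp add: qform_def)
qed

end

locale singular_family = gapped_family \<Theta> a b K La
  for \<Theta> :: "(real ^ 'n::finite) set"
    and a b :: "('n, 'h::chilbert_space) form_family" and K La +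
  fixes Vs Z :: "'h set" and Ls KZ :: real
  assumes removable: "removable_singularity \<Theta> a b Vs Ls"
    and complementary: "complementary a b Vs Z KZ"
begin

lemma zero_in: "0 \<in> \<Theta>" and closed_Vs: "closed_csubspace Vs" and Ls_nonneg: "0 \<le> Ls"
  using removable by (simp_all add: removable_singularity_def)

lemma Vst_near: "\<theta>1 \<in> \<Theta> \<Longrightarrow> \<theta>2 \<in> \<Theta> \<Longrightarrow> v \<in> Vst a Vs \<theta>1 \<Longrightarrow>
  (INF v2\<in>Vst a Vs \<theta>2. tnorm a b \<theta>2 (v - v2)) \<le> Ls * norm (\<theta>1 - \<theta>2) * tnorm a b \<theta>1 v"
  using removable by (simp add: removable_singularity_def)

lemma closed_Z: "closed_csubspace Z" and KZ: "0 \<le> KZ" "KZ < 1"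
  and angle_KZ: "v \<in> Vs \<Longrightarrow> z \<in> Z \<Longrightarrow> cmod (ip a b 0 v z) \<le> KZ * tnorm a b 0 v * tnorm a b 0 z"
  using complementary by (simp_all add: complementary_def)

lemma kerV_0: "kerV a 0 = {v + z | v z. v \<in> Vs \<and> z \<in> Z}"
  using complementary unfolding complementary_def by (elim conjE)

lemma Vs_subset: "Vs \<subseteq> kerV a 0" and Z_subset: "Z \<subseteq> kerV a 0"
proof -
  have 0: "0 \<in> Vs" "0 \<in> Z"
    using closed_Vs closed_Z by (auto simp: closed_csubspace_def csubspace_def)
  show "Vs \<subseteq> kerV a 0"
  proof
    fix v assume "v \<in> Vs"
    moreover have "v = v + 0" by simp
    ultimately show "v \<in> kerV a 0" unfolding kerV_0 using 0 by blast
  qed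
  show "Z \<subseteq> kerV a 0"
  proof
    fix z assume "z \<in> Z"
    moreover have "z = 0 + z" by simp
    ultimately show "z \<in> kerV a 0" unfolding kerV_0 using 0 by blast
  qed
qed

lemma Vst_0: "Vst a Vs 0 = Vs"
  by (simp add: Vst_def)

lemma closed_Vst: "\<theta> \<in> \<Theta> \<Longrightarrow> closed_csubspace (Vst a Vs \<theta>)"
  using closed_Vs closed_kerV by (simp add: Vst_def)

lemma Vst_subset: "\<theta> \<in> \<Theta> \<Longrightarrow> Vst a Vs \<theta> \<subseteq> kerV a \<theta>"
  using Vs_subset by (simp add: Vst_def)

text \<open>
  \<open>w\<close> is \<open>\<theta>\<close>-orthogonal to a space close to \<open>kerV a \<theta>0\<close>, so its component in
  \<open>orthW a b \<theta>0\<close> has a norm comparable to that of \<open>w\<close>.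
\<close>

lemma gap_bound_perturbation:
  assumes \<theta>: "\<theta>0 \<in> \<Theta>" "\<theta> \<in> \<Theta>" "\<theta>0 \<noteq> 0" "\<theta> \<noteq> 0"
    and c: "gap_bound a b \<theta>0 c"
    and small: "2 * (Ls * norm (\<theta>0 - \<theta>) * K) \<le> 1"
      "La * norm (\<theta>0 - \<theta>) * K\<^sup>2 \<le> c / (8 * K\<^sup>2)"
  shows "gap_bound a b \<theta> (c / (8 * K\<^sup>2))"
proof -
  interpret P0: form_pair "a \<theta>0" "b \<theta>0" by (rule form_pair[OF \<theta>(1)])
  interpret P: form_pair "a \<theta>" "b \<theta>" by (rule form_pair[OF \<theta>(2)])
  let ?d = "norm (\<theta>0 - \<theta>)"
  let ?M = "tnorm a b \<theta>0" and ?N = "tnorm a b \<theta>"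
  have c0: "0 < c" using c by (simp add: gap_bound_def)
  note K = K_pos
  have "c / (8 * K\<^sup>2) * (?N w)\<^sup>2 \<le> qform (a \<theta>) w" if w: "w \<in> orthW a b \<theta>" for w
  proof -
    obtain v0 w0 where vw: "v0 \<in> kerV a \<theta>0" "w0 \<in> orthW a b \<theta>0" "w = v0 + w0"
      by (rule kerV_orthW_decomposition[OF \<theta>(1)])
    have "?N w - ?N w0 \<le> (INF v\<in>Vst a Vs \<theta>. ?N (v0 - v))"
    proof (rule cINF_greatest)
      show "Vst a Vs \<theta> \<noteq> {}"
        using closed_Vst[OF \<theta>(2)] by (auto simp: closed_csubspace_def csubspace_def)
      fix v assume v: "v \<in> Vst a Vs \<theta>"
      have "form_sum (a \<theta>) (b \<theta>) w (- v) = 0"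
        using w v \<theta>(4) by (simp add: orthW_eq Vst_def)
      from P.sum.form_norm_orthogonal(1)[OF this]
      have "?N w \<le> ?N (w0 + (v0 - v))" by (simp add: tnorm_eq vw(3) algebra_simps)
      also have "\<dots> \<le> ?N w0 + ?N (v0 - v)"
        unfolding tnorm_eq by (rule P.sum.form_norm_triangle)
      finally show "?N w - ?N w0 \<le> ?N (v0 - v)" by simp
    qed
    also have "\<dots> \<le> Ls * ?d * ?M v0"
      using vw(1) \<theta>(3) by (intro Vst_near \<theta>(1,2)) (simp add: Vst_def)
    also have "\<dots> \<le> Ls * ?d * (K * ?N w)"
    proof (rule mult_left_mono)
      have "?M v0 \<le> ?M w"
        unfolding tnorm_eq vw(3)
        by (rule P0.sum.form_norm_orthogonal(1)) (rule kerV_orthogonal[OF \<theta>(1) vw(1,2)])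
      also have "\<dots> \<le> K * ?N w" by (rule tnorm_le[OF \<theta>(1,2)])
      finally show "?M v0 \<le> K * ?N w" .
    qed (simp add: Ls_nonneg)
    also have "\<dots> = (Ls * ?d * K) * ?N w" by simp
    finally have "2 * ?N w \<le> 2 * ?N w0 + (2 * (Ls * ?d * K)) * ?N w" by simp
    also have "(2 * (Ls * ?d * K)) * ?N w \<le> 1 * ?N w"
      using small(1) by (intro mult_right_mono) (simp_all add: tnorm_eq)
    finally have "?N w \<le> 2 * ?N w0" by simp
    also have "\<dots> \<le> 2 * K * ?M w0"
      using tnorm_le[OF \<theta>(2,1), of w0] by simp
    finally have "(?N w)\<^sup>2 \<le> (2 * K * ?M w0)\<^sup>2"
      by (rule power_mono) (simp add: tnorm_eq)
    then have "c / (4 * K\<^sup>2) * (?N w)\<^sup>2 \<le> c / (4 * K\<^sup>2) * (2 * K * ?M w0)\<^sup>2"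
      using c0 by (intro mult_left_mono) auto
    also have "\<dots> = c * (?M w0)\<^sup>2" using K by (simp add: power_mult_distrib)
    also have "\<dots> \<le> qform (a \<theta>0) w0" using c vw(2) by (simp add: gap_bound_def)
    also have "\<dots> = qform (a \<theta>0) w"
      using vw(1) by (simp add: vw(3) P0.\<alpha>.qform_add P0.\<alpha>.qform_zero_imp_left kerV_def)
    finally have 1: "c / (4 * K\<^sup>2) * (?N w)\<^sup>2 \<le> qform (a \<theta>0) w" .
    have "La * ?d * (?M w)\<^sup>2 \<le> La * ?d * (K * ?N w)\<^sup>2"
      using La_pos tnorm_le[OF \<theta>(1,2), of w]
      by (intro mult_left_mono power_mono) (auto simp: tnorm_eq)
    also have "\<dots> = (La * ?d * K\<^sup>2) * (?N w)\<^sup>2" by (simp add: power_mult_distrib)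
    also have "\<dots> \<le> c / (8 * K\<^sup>2) * (?N w)\<^sup>2"
      using small(2) by (intro mult_right_mono) auto
    finally have 2: "La * ?d * (?M w)\<^sup>2 \<le> c / (8 * K\<^sup>2) * (?N w)\<^sup>2" .
    have "c / (4 * K\<^sup>2) = c / (8 * K\<^sup>2) + c / (8 * K\<^sup>2)" by simp
    then have 3: "c / (4 * K\<^sup>2) * (?N w)\<^sup>2 = c / (8 * K\<^sup>2) * (?N w)\<^sup>2 + c / (8 * K\<^sup>2) * (?N w)\<^sup>2"
      by (simp only: distrib_right)
    show ?thesis using 1 2 3 qform_a_Lipschitz[OF \<theta>(1,2), of w] by linarith
  qed
  moreover have "0 < c / (8 * K\<^sup>2)" using c0 K by simp
  ultimately show ?thesis by (simp add: gap_bound_def)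
qed

lemma nu_locally_bounded_below:
  assumes \<theta>0: "\<theta>0 \<in> \<Theta>" "\<theta>0 \<noteq> 0"
  shows "\<exists>e>0. \<exists>m>0. \<forall>\<theta>\<in>\<Theta>. \<theta> \<noteq> 0 \<longrightarrow> dist \<theta>0 \<theta> < e \<longrightarrow> m \<le> nu a b \<theta>"
proof -
  define c where "c = nu a b \<theta>0"
  have c: "gap_bound a b \<theta>0 c" "0 < c"
    unfolding c_def using gap_bound_nu[OF \<theta>0(1)] nu_pos[OF \<theta>0(1)] by auto
  note K = K_pos and La = La_pos
  define e where "e = min (1 / (2 * K * (Ls + 1))) (c / (8 * K\<^sup>2 * La * K\<^sup>2))"
  have e: "0 < e" using K La c Ls_nonneg by (simp add: e_def)
  show ?thesis
  proof (intro exI conjI ballI impI)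
    show "0 < e" "0 < min 1 (c / (8 * K\<^sup>2))" using e c K by auto
    fix \<theta> assume \<theta>: "\<theta> \<in> \<Theta>" "\<theta> \<noteq> 0" "dist \<theta>0 \<theta> < e"
    let ?d = "norm (\<theta>0 - \<theta>)"
    have d: "?d \<le> 1 / (2 * K * (Ls + 1))" "?d \<le> c / (8 * K\<^sup>2 * La * K\<^sup>2)"
      using \<theta>(3) by (auto simp: e_def dist_norm)
    have "2 * (Ls * ?d * K) \<le> (2 * K * (Ls + 1)) * ?d"
      using K by (simp add: algebra_simps)
    also have "\<dots> \<le> (2 * K * (Ls + 1)) * (1 / (2 * K * (Ls + 1)))"
      using K Ls_nonneg by (intro mult_left_mono d) auto
    also have "\<dots> = 1" using K Ls_nonneg by simp
    finally have 1: "2 * (Ls * ?d * K) \<le> 1" .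
    have "La * ?d * K\<^sup>2 \<le> La * (c / (8 * K\<^sup>2 * La * K\<^sup>2)) * K\<^sup>2"
      using La by (intro mult_right_mono mult_left_mono d) auto
    also have "\<dots> = c / (8 * K\<^sup>2)" using K La by (simp add: power2_eq_square)
    finally have 2: "La * ?d * K\<^sup>2 \<le> c / (8 * K\<^sup>2)" .
    show "min 1 (c / (8 * K\<^sup>2)) \<le> nu a b \<theta>"
      by (rule nu_ge[OF \<theta>(1) gap_bound_perturbation[OF \<theta>0(1) \<theta>(1) \<theta>0(2) \<theta>(2) c(1) 1 2]])
  qed
qed

lemma nu_inf_pos:
  assumes r: "0 < r"
  shows "0 < nu_inf \<Theta> a b r"
proof -
  let ?C = "{\<theta>\<in>\<Theta>. norm \<theta> \<ge> r}"
  have C: "compact ?C"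
  proof -
    have "closed {\<theta>::real^'n. norm \<theta> \<ge> r}" by (intro closed_Collect_le continuous_intros)
    with compact have "compact (\<Theta> \<inter> {\<theta>. norm \<theta> \<ge> r})" by (rule compact_Int_closed)
    moreover have "\<Theta> \<inter> {\<theta>. norm \<theta> \<ge> r} = ?C" by blast
    ultimately show ?thesis by simp
  qed
  define good where "good \<theta>0 e m \<longleftrightarrow> 0 < e \<and> 0 < m \<and>
    (\<forall>\<theta>\<in>\<Theta>. \<theta> \<noteq> 0 \<longrightarrow> dist \<theta>0 \<theta> < e \<longrightarrow> m \<le> nu a b \<theta>)" for \<theta>0 e m
  have "\<forall>\<theta>0\<in>?C. \<exists>e m. good \<theta>0 e m"
  proof
    fix \<theta>0 assume "\<theta>0 \<in> ?C"
    then have "\<theta>0 \<in> \<Theta>" "\<theta>0 \<noteq> 0" using r by auto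
    from nu_locally_bounded_below[OF this] show "\<exists>e m. good \<theta>0 e m"
      unfolding good_def by blast
  qed
  from bchoice[OF this] obtain e where "\<forall>\<theta>0\<in>?C. \<exists>m. good \<theta>0 (e \<theta>0) m" ..
  from bchoice[OF this] obtain m where em: "\<forall>\<theta>0\<in>?C. good \<theta>0 (e \<theta>0) (m \<theta>0)" ..
  have cover: "?C \<subseteq> (\<Union>x\<in>?C. ball x (e x))"
  proof
    fix x assume x: "x \<in> ?C"
    with em have "x \<in> ball x (e x)" by (simp add: good_def)
    with x show "x \<in> (\<Union>x\<in>?C. ball x (e x))" by blast
  qed
  obtain D where D: "D \<subseteq> ?C" "finite D" "?C \<subseteq> (\<Union>x\<in>D. ball x (e x))"
    by (rule compactE_image[OF C open_ball cover]) (rule that)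
  define m0 where "m0 = Min (insert 1 (m ` D))"
  have m0: "0 < m0" unfolding m0_def using D(1,2) em by (auto simp: good_def)
  have "ereal m0 \<le> nu_inf \<Theta> a b r"
    unfolding nu_inf_def
  proof (rule INF_greatest)
    fix \<theta> assume \<theta>: "\<theta> \<in> ?C"
    with D(3) have "\<theta> \<in> (\<Union>x\<in>D. ball x (e x))" by (rule subsetD)
    then obtain x where x: "x \<in> D" "dist x \<theta> < e x" by auto
    have "m0 \<le> m x" unfolding m0_def using D(2) x(1) by (intro Min_le) auto
    also have "m x \<le> nu a b \<theta>"
    proof -
      have "good x (e x) (m x)" using em D(1) x(1) by blast
      moreover have "\<theta> \<in> \<Theta>" "\<theta> \<noteq> 0" using \<theta> r by auto
      ultimately show ?thesis using x(2) by (simp add: good_def)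
    qed
    finally show "ereal m0 \<le> ereal (nu a b \<theta>)" by simp
  qed
  moreover have "0 < ereal m0" using m0 by simp
  ultimately show ?thesis by (rule order_less_le_trans[rotated])
qed

lemma Vst_close:
  assumes \<theta>: "\<theta>1 \<in> \<Theta>" "\<theta>2 \<in> \<Theta>" and v: "v \<in> Vst a Vs \<theta>1"
    and lt: "Ls * norm (\<theta>1 - \<theta>2) * tnorm a b \<theta>1 v < t"
  shows "\<exists>v2\<in>Vst a Vs \<theta>2. tnorm a b \<theta>2 (v - v2) < t"
proof -
  have "(INF v2\<in>Vst a Vs \<theta>2. tnorm a b \<theta>2 (v - v2)) < t"
    using Vst_near[OF \<theta> v] lt by (rule order_le_less_trans)
  moreover have "Vst a Vs \<theta>2 \<noteq> {}"
    using closed_Vst[OF \<theta>(2)] by (auto simp: closed_csubspace_def csubspace_def)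
  ultimately show ?thesis
    using cInf_lessD[of "(\<lambda>v2. tnorm a b \<theta>2 (v - v2)) ` Vst a Vs \<theta>2" t] by auto
qed

lemma Vs_Vst_close:
  assumes \<theta>: "\<theta> \<in> \<Theta>" and small: "3 * (K * Ls * norm \<theta>) < 1 - KZ"
  shows "v \<in> Vs \<Longrightarrow> \<exists>y\<in>Vst a Vs \<theta>. tnorm a b 0 (v - y) \<le> (1 - KZ) / 3 * tnorm a b 0 v"
    and "v \<in> Vst a Vs \<theta> \<Longrightarrow> \<exists>y\<in>Vs. tnorm a b 0 (v - y) \<le> (1 - KZ) / 3 * tnorm a b 0 v"
proof -
  interpret P0: form_pair "a 0" "b 0" by (rule form_pair[OF zero_in])
  let ?M = "tnorm a b 0" and ?N = "tnorm a b \<theta>"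
  note K = K_pos
  have zero: "0 \<in> Vst a Vs \<theta>" "0 \<in> Vs"
    using closed_Vst[OF \<theta>] closed_Vs by (auto simp: closed_csubspace_def csubspace_def)
  have small': "K * Ls * norm \<theta> < (1 - KZ) / 3" using small by simp
  show "\<exists>y\<in>Vst a Vs \<theta>. ?M (v - y) \<le> (1 - KZ) / 3 * ?M v" if v: "v \<in> Vs"
  proof (cases "v = 0")
    case True
    then show ?thesis using zero by (intro bexI[of _ 0]) (simp_all add: tnorm_eq)
  next
    case False
    then have pos: "0 < ?M v" by (simp add: tnorm_eq P0.sum.form_norm_pos_iff)
    have "K * (Ls * norm (0 - \<theta>) * ?M v) < K * ((1 - KZ) / 3 * ?M v / K)"
      using mult_strict_right_mono[OF small' pos] K by (simp add: mult.assoc)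
    then have "Ls * norm (0 - \<theta>) * ?M v < (1 - KZ) / 3 * ?M v / K"
      using K by (rule mult_left_less_imp_less[OF _ less_imp_le])
    from Vst_close[OF zero_in \<theta> _ this] v
    obtain y where y: "y \<in> Vst a Vs \<theta>" "?N (v - y) < (1 - KZ) / 3 * ?M v / K"
      by (auto simp: Vst_0)
    have "?M (v - y) \<le> K * ?N (v - y)" by (rule tnorm_le[OF zero_in \<theta>])
    also have "\<dots> \<le> K * ((1 - KZ) / 3 * ?M v / K)"
      using K y(2) by (intro mult_left_mono) auto
    finally show ?thesis using y(1) K by (intro bexI[of _ y]) simp_all
  qed
  show "\<exists>y\<in>Vs. ?M (v - y) \<le> (1 - KZ) / 3 * ?M v" if v: "v \<in> Vst a Vs \<theta>"
  proof (cases "v = 0")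
    case True
    then show ?thesis using zero by (intro bexI[of _ 0]) (simp_all add: tnorm_eq)
  next
    case False
    then have pos: "0 < ?M v" by (simp add: tnorm_eq P0.sum.form_norm_pos_iff)
    have "Ls * norm (\<theta> - 0) * ?N v \<le> Ls * norm (\<theta> - 0) * (K * ?M v)"
      using tnorm_le[OF \<theta> zero_in] Ls_nonneg by (intro mult_left_mono) auto
    also have "\<dots> = (K * Ls * norm \<theta>) * ?M v" by simp
    also have "\<dots> < (1 - KZ) / 3 * ?M v" by (rule mult_strict_right_mono[OF small' pos])
    finally obtain y where y: "y \<in> Vs" "?M (v - y) < (1 - KZ) / 3 * ?M v"
      using Vst_close[OF \<theta> zero_in v] unfolding Vst_0 by blast
    then show ?thesis by (intro bexI[of _ y]) simp_all
  qed
qed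

abbreviation "Z_plus_W \<equiv> {z + w | z w. z \<in> Z \<and> w \<in> orthW a b 0}"

lemma Vst_complement:
  assumes \<theta>: "\<theta> \<in> \<Theta>" and small: "3 * (K * Ls * norm \<theta>) < 1 - KZ"
  shows "\<exists>v\<in>Vst a Vs \<theta>. \<exists>x\<in>Z_plus_W. u = v + x" and "Vst a Vs \<theta> \<inter> Z_plus_W = {0}"
proof -
  interpret P0: form_pair "a 0" "b 0" by (rule form_pair[OF zero_in])
  have orth: "form_sum (a 0) (b 0) v w = 0" if "v \<in> kerV a 0" "w \<in> orthW a b 0" for v w
    using kerV_orthogonal[OF zero_in that] .
  have X: "closed_csubspace Z_plus_W"
  proof (rule P0.sum.closed_sum[OF closed_Z closed_orthW[OF zero_in], of 1])
    fix z w assume "z \<in> Z" "w \<in> orthW a b 0"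
    then show "1 * form_norm (form_sum (a 0) (b 0)) z \<le> form_norm (form_sum (a 0) (b 0)) (z + w)"
      using P0.sum.form_norm_orthogonal(1)[OF orth] Z_subset by auto
  qed simp
  have AX: "\<exists>v\<in>Vs. \<exists>x\<in>Z_plus_W. u = v + x" for u
  proof -
    obtain v0 w where vw: "v0 \<in> kerV a 0" "w \<in> orthW a b 0" "u = v0 + w"
      by (rule kerV_orthW_decomposition[OF zero_in])
    obtain v z where vz: "v \<in> Vs" "z \<in> Z" "v0 = v + z" using vw(1) unfolding kerV_0 by blast
    have "u = v + (z + w)" "z + w \<in> Z_plus_W"
      using vw vz by (auto simp: add.assoc)
    with vz(1) show ?thesis by blast
  qed
  have angle: "cmod (form_sum (a 0) (b 0) v x) \<le>
      KZ * form_norm (form_sum (a 0) (b 0)) v * form_norm (form_sum (a 0) (b 0)) x"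
    if v: "v \<in> Vs" and x: "x \<in> Z_plus_W" for v x
  proof -
    obtain z w where zw: "z \<in> Z" "w \<in> orthW a b 0" "x = z + w" using x by blast
    have "form_sum (a 0) (b 0) v x = form_sum (a 0) (b 0) v z"
      using orth[of v w] v Vs_subset zw by (auto simp: P0.sum.add_right)
    then have "cmod (form_sum (a 0) (b 0) v x) \<le>
      KZ * form_norm (form_sum (a 0) (b 0)) v * form_norm (form_sum (a 0) (b 0)) z"
      using angle_KZ[OF v zw(1)] by (simp add: ip_def tnorm_eq)
    also have "\<dots> \<le> KZ * form_norm (form_sum (a 0) (b 0)) v * form_norm (form_sum (a 0) (b 0)) x"
      using P0.sum.form_norm_orthogonal(1)[OF orth, of z w] zw Z_subset KZ
      by (intro mult_left_mono) auto
    finally show ?thesis .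
  qed
  note close = Vs_Vst_close[OF \<theta> small, unfolded tnorm_eq]
  note pert = P0.sum.complement_perturbation[where A = Vs, OF closed_Vst[OF \<theta>] X KZ AX angle close]
  show "\<exists>v\<in>Vst a Vs \<theta>. \<exists>x\<in>Z_plus_W. u = v + x" by (rule pert(1))
  show "Vst a Vs \<theta> \<inter> Z_plus_W = {0}" by (rule pert(2))
qed

lemma
  assumes \<theta>: "\<theta> \<in> \<Theta>" and small: "2 * (La * norm \<theta>) \<le> nu a b 0"
  shows coercive_W: "\<And>w. w \<in> orthW a b 0 \<Longrightarrow> nu a b 0 / 2 * (tnorm a b 0 w)\<^sup>2 \<le> qform (a \<theta>) w"
    and mapN_in: "mapN a b \<theta> v \<in> orthW a b 0"
    and mapN_eq: "\<And>w. w \<in> orthW a b 0 \<Longrightarrow> a \<theta> (mapN a b \<theta> v) w = - a \<theta> v w"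
    and mapN_unique: "\<And>w. w \<in> orthW a b 0 \<Longrightarrow>
      (\<And>w'. w' \<in> orthW a b 0 \<Longrightarrow> a \<theta> w w' = - a \<theta> v w') \<Longrightarrow> mapN a b \<theta> v = w"
proof -
  interpret P0: form_pair "a 0" "b 0" by (rule form_pair[OF zero_in])
  interpret P: form_pair "a \<theta>" "b \<theta>" by (rule form_pair[OF \<theta>])
  interpret ab: bounded_bilinear "a \<theta>" by (rule P.bounded_bilinear_left)
  have nu0: "0 < nu a b 0" by (rule nu_pos[OF zero_in])
  show coercive: "nu a b 0 / 2 * (tnorm a b 0 w)\<^sup>2 \<le> qform (a \<theta>) w"
    if w: "w \<in> orthW a b 0" for w
  proof -
    have "La * norm (0 - \<theta>) * (tnorm a b 0 w)\<^sup>2 \<le> nu a b 0 / 2 * (tnorm a b 0 w)\<^sup>2"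
      using small by (intro mult_right_mono) auto
    then show ?thesis
      using nu_le[OF zero_in w] qform_a_Lipschitz[OF zero_in \<theta>, of w] by linarith
  qed
  let ?sol = "\<lambda>w. w \<in> orthW a b 0 \<and> (\<forall>w'\<in>orthW a b 0. a \<theta> w w' = - a \<theta> v w')"
  have "\<exists>w\<in>orthW a b 0. \<forall>w'\<in>orthW a b 0. a \<theta> w w' = - a \<theta> v w'"
  proof (rule P0.sum.exists_solution[OF P.\<alpha>.nonneg_sesquilinear_axioms P.bounded_bilinear_left
        closed_orthW[OF zero_in], of "nu a b 0 / 2"])
    show "bounded_linear (\<lambda>w. - a \<theta> v w)"
      by (intro bounded_linear_minus ab.bounded_linear_right)
  qed (use nu0 coercive in \<open>auto simp: tnorm_eq P.\<alpha>.scaleC_right\<close>)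
  then obtain w0 where w0: "?sol w0" by blast
  have unique: "w = w0" if "?sol w" for w
  proof (rule P.\<alpha>.solution_unique[of "orthW a b 0"])
    show "csubspace (orthW a b 0)"
      using closed_orthW[OF zero_in] by (simp add: closed_csubspace_def)
    fix x assume x: "x \<in> orthW a b 0" "qform (a \<theta>) x = 0"
    from coercive[OF x(1)] have "nu a b 0 / 2 * (tnorm a b 0 x)\<^sup>2 \<le> 0" by (simp only: x(2))
    with nu0 have "tnorm a b 0 x = 0" by (simp add: mult_le_0_iff)
    then show "x = 0" unfolding tnorm_eq by simp
  qed (use w0 that in auto)
  have THE: "mapN a b \<theta> v = w0" unfolding mapN_def using w0 unique by (rule the_equality)
  show "mapN a b \<theta> v \<in> orthW a b 0" using w0 by (simp add: THE)
  show "a \<theta> (mapN a b \<theta> v) w = - a \<theta> v w" if "w \<in> orthW a b 0" for w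
    using w0 that by (simp add: THE)
  show "mapN a b \<theta> v = w" if "w \<in> orthW a b 0"
    "\<And>w'. w' \<in> orthW a b 0 \<Longrightarrow> a \<theta> w w' = - a \<theta> v w'" for w
    unfolding THE by (rule unique[symmetric]) (use that in blast)
qed

context
  fixes \<theta>
  assumes \<theta>: "\<theta> \<in> \<Theta>" and small_a: "2 * (La * norm \<theta>) \<le> nu a b 0"
    and small_V: "3 * (K * Ls * norm \<theta>) < 1 - KZ"
begin

interpretation P: form_pair "a \<theta>" "b \<theta>" by (rule form_pair[OF \<theta>])

abbreviation "annihilator_W \<equiv> {u. \<forall>w\<in>orthW a b 0. a \<theta> u w = 0}"

lemma mapM_in:
  assumes v: "v \<in> Vst a Vs \<theta>"
  shows "v + mapM a b \<theta> z \<in> annihilator_W"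
proof (intro CollectI ballI)
  fix w assume w: "w \<in> orthW a b 0"
  have "a \<theta> v w = 0" using v Vst_subset[OF \<theta>] by (intro kerV_left[OF \<theta>]) blast
  then show "a \<theta> (v + mapM a b \<theta> z) w = 0"
    using mapN_eq[OF \<theta> small_a w, of z] by (simp add: mapM_def P.\<alpha>.add_left)
qed

lemma annihilator_decomposition:
  assumes u: "u \<in> annihilator_W"
  obtains v z where "v \<in> Vst a Vs \<theta>" "z \<in> Z" "u = v + mapM a b \<theta> z"
proof -
  obtain v x where v: "v \<in> Vst a Vs \<theta>" and x: "x \<in> Z_plus_W" and ux: "u = v + x"
    using Vst_complement(1)[OF \<theta> small_V, of u] by blast
  obtain z w where zw: "z \<in> Z" "w \<in> orthW a b 0" "x = z + w" using x by blast
  have "mapN a b \<theta> z = w"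
  proof (rule mapN_unique[OF \<theta> small_a zw(2)])
    fix w' assume "w' \<in> orthW a b 0"
    then have "a \<theta> (v + (z + w)) w' = 0" using u by (simp add: ux zw(3))
    moreover have "a \<theta> v w' = 0" using v Vst_subset[OF \<theta>] by (intro kerV_left[OF \<theta>]) blast
    ultimately show "a \<theta> w w' = - a \<theta> z w'"
      by (simp add: P.\<alpha>.add_left eq_neg_iff_add_eq_0 add.commute)
  qed
  with ux zw(3) have "u = v + mapM a b \<theta> z" by (simp add: mapM_def)
  with v zw(1) show ?thesis by (rule that)
qed

lemma mapM_decomposition_unique:
  assumes "v \<in> Vst a Vs \<theta>" "v' \<in> Vst a Vs \<theta>" "z \<in> Z" "z' \<in> Z"
    and eq: "v + mapM a b \<theta> z = v' + mapM a b \<theta> z'"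
  shows "v = v'" "z = z'"
proof -
  let ?w = "mapN a b \<theta> z' - mapN a b \<theta> z"
  have w: "?w \<in> orthW a b 0" "mapN a b \<theta> z - mapN a b \<theta> z' \<in> orthW a b 0"
    by (intro closed_csubspace_diff[OF closed_orthW[OF zero_in]] mapN_in[OF \<theta> small_a])+
  have z: "z' - z \<in> Z" by (intro closed_csubspace_diff[OF closed_Z] assms)
  have "v - v' = (z' - z) + ?w" using eq by (simp add: mapM_def algebra_simps)
  then have "v - v' \<in> Z_plus_W" using z w by blast
  moreover have "v - v' \<in> Vst a Vs \<theta>"
    by (intro closed_csubspace_diff[OF closed_Vst[OF \<theta>]] assms)
  ultimately have "v - v' \<in> {0}" unfolding Vst_complement(2)[OF \<theta> small_V, symmetric] by blast
  then show v: "v = v'" by simp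
  have "z' - z = mapN a b \<theta> z - mapN a b \<theta> z'"
    using eq by (simp add: v mapM_def algebra_simps)
  then have "z' - z \<in> orthW a b 0" using w(2) by simp
  moreover have "z' - z \<in> kerV a 0" using z Z_subset by (rule subsetD[rotated])
  ultimately have "z' - z = 0" by (intro kerV_inter_orthW[OF zero_in])
  then show "z = z'" by simp
qed

lemma vz_sol_spec:
  assumes \<epsilon>: "0 < \<epsilon>" "\<epsilon> < 1" and f: "f \<in> antidual"
  obtains u0 where "u0 \<in> annihilator_W" "\<And>s. s \<in> annihilator_W \<Longrightarrow> P.scaled_sum \<epsilon> u0 s = f s"
    "(case vz_sol a b Vs Z f \<epsilon> \<theta> of (v, z) \<Rightarrow> v + mapM a b \<theta> z) = u0"
proof -
  have "closed_csubspace annihilator_W"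
    by (rule P.closed_csubspace_annihilator[OF P.\<alpha>.nonneg_sesquilinear_axioms
          P.bounded_bilinear_left])
  from P.scaled_sum_solution[OF \<epsilon> f this]
  obtain u0 where u0: "u0 \<in> annihilator_W \<and> (\<forall>s\<in>annihilator_W. P.scaled_sum \<epsilon> u0 s = f s)"
    and u0_unique: "\<forall>u. u \<in> annihilator_W \<and> (\<forall>s\<in>annihilator_W. P.scaled_sum \<epsilon> u s = f s)
      \<longrightarrow> u = u0" by (rule ex1E)
  have u0_in: "u0 \<in> annihilator_W" using u0 by (rule conjunct1)
  have u0_eq: "P.scaled_sum \<epsilon> u0 s = f s" if "s \<in> annihilator_W" for s
    by (rule bspec[OF conjunct2[OF u0] that])
  obtain v z where vz: "v \<in> Vst a Vs \<theta>" "z \<in> Z" "u0 = v + mapM a b \<theta> z"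
    by (rule annihilator_decomposition[OF u0_in])
  have form_eq: "P.scaled_sum \<epsilon> (v1 + mapM a b \<theta> z1) (v2 + mapM a b \<theta> z2) =
      complex_of_real (1 / \<epsilon>\<^sup>2) * a \<theta> (mapM a b \<theta> z1) (mapM a b \<theta> z2) +
      b \<theta> (v1 + mapM a b \<theta> z1) (v2 + mapM a b \<theta> z2)"
    if "v1 \<in> Vst a Vs \<theta>" "v2 \<in> Vst a Vs \<theta>" for v1 v2 z1 z2
  proof -
    have "v1 \<in> kerV a \<theta>" "v2 \<in> kerV a \<theta>" using that Vst_subset[OF \<theta>] by auto
    then have "a \<theta> (v1 + mapM a b \<theta> z1) (v2 + mapM a b \<theta> z2) =
      a \<theta> (mapM a b \<theta> z1) (mapM a b \<theta> z2)"
      by (simp add: P.\<alpha>.add_left P.\<alpha>.add_right kerV_left[OF \<theta>] kerV_right[OF \<theta>])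
    then show ?thesis by (simp add: P.scaled_sum_def)
  qed
  define sol where "sol v z \<longleftrightarrow> v \<in> Vst a Vs \<theta> \<and> z \<in> Z \<and> (\<forall>v'\<in>Vst a Vs \<theta>. \<forall>z'\<in>Z.
        complex_of_real (1 / \<epsilon>\<^sup>2) * a \<theta> (mapM a b \<theta> z) (mapM a b \<theta> z') +
        b \<theta> (v + mapM a b \<theta> z) (v' + mapM a b \<theta> z') = f (v' + mapM a b \<theta> z'))" for v z
  have sol: "sol v z"
    unfolding sol_def
  proof (intro conjI ballI vz(1,2))
    fix v' z' assume v': "v' \<in> Vst a Vs \<theta>"
    show "complex_of_real (1 / \<epsilon>\<^sup>2) * a \<theta> (mapM a b \<theta> z) (mapM a b \<theta> z') +
        b \<theta> (v + mapM a b \<theta> z) (v' + mapM a b \<theta> z') = f (v' + mapM a b \<theta> z')"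
      using u0_eq[OF mapM_in[OF v', of z']] unfolding vz(3) form_eq[OF vz(1) v'] .
  qed
  have sol_unique: "v' = v \<and> z' = z" if "sol v' z'" for v' z'
  proof -
    have v': "v' \<in> Vst a Vs \<theta>" and z': "z' \<in> Z"
      using that unfolding sol_def by blast+
    have eq: "P.scaled_sum \<epsilon> (v' + mapM a b \<theta> z') s = f s" if s_in: "s \<in> annihilator_W" for s
    proof -
      obtain v2 z2 where s: "v2 \<in> Vst a Vs \<theta>" "z2 \<in> Z" "s = v2 + mapM a b \<theta> z2"
        by (rule annihilator_decomposition[OF s_in])
      show ?thesis
        unfolding s(3) form_eq[OF v' s(1)] using \<open>sol v' z'\<close> s(1,2) unfolding sol_def by blast
    qed
    have "v' + mapM a b \<theta> z' = u0"
      by (rule mp[OF spec[OF u0_unique]]) (intro conjI ballI mapM_in[OF v'] eq)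
    then have "v' + mapM a b \<theta> z' = v + mapM a b \<theta> z" by (simp only: vz(3))
    from mapM_decomposition_unique[OF v' vz(1) z' vz(2) this] show ?thesis ..
  qed
  have "vz_sol a b Vs Z f \<epsilon> \<theta> = (THE (v, z). sol v z)"
    unfolding vz_sol_def sol_def ..
  also have "\<dots> = (v, z)"
  proof (rule the_equality)
    show "case (v, z) of (v, z) \<Rightarrow> sol v z" using sol by simp
    show "y = (v, z)" if "case y of (v, z) \<Rightarrow> sol v z" for y
      using that sol_unique[of "fst y" "snd y"] by (simp add: case_prod_beta prod_eq_iff)
  qed
  finally show ?thesis using vz(3) by (intro that[OF u0_in u0_eq]) simp_all
qed

end

lemma u_sol_spec:
  assumes \<theta>: "\<theta> \<in> \<Theta>" and \<epsilon>: "0 < \<epsilon>" "\<epsilon> < 1" and f: "f \<in> antidual"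
  shows "form_pair.scaled_sum (a \<theta>) (b \<theta>) \<epsilon> (u_sol a b f \<epsilon> \<theta>) w = f w"
proof -
  interpret P: form_pair "a \<theta>" "b \<theta>" by (rule form_pair[OF \<theta>])
  have "closed_csubspace (UNIV :: 'h set)" by (simp add: closed_csubspace_def csubspace_def)
  from P.scaled_sum_solution[OF \<epsilon> f this]
  have "\<exists>!u. \<forall>w. P.scaled_sum \<epsilon> u w = f w" by simp
  then have "\<forall>w. P.scaled_sum \<epsilon> (THE u. \<forall>w. P.scaled_sum \<epsilon> u w = f w) w = f w" by (rule theI')
  then show ?thesis by (simp add: u_sol_def P.scaled_sum_def)
qed

lemma radius_bounds:
  assumes "0 < r1" "r1 \<le> radius_r0 a b K La Ls KZ" "norm \<theta> < r1"
  shows "2 * (La * norm \<theta>) \<le> nu a b 0" "3 * (K * Ls * norm \<theta>) < 1 - KZ"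
proof -
  have "norm \<theta> < nu a b 0 / (2 * La)"
    using assms by (auto simp: radius_r0_def split: if_splits)
  then show "2 * (La * norm \<theta>) \<le> nu a b 0" using La_pos by (simp add: field_simps)
  show "3 * (K * Ls * norm \<theta>) < 1 - KZ"
  proof (cases "Ls = 0")
    case True
    then show ?thesis using KZ by simp
  next
    case False
    then have "norm \<theta> < (1 - KZ) / (3 * K * Ls)" "0 < 3 * K * Ls"
      using assms K_pos Ls_nonneg by (auto simp: radius_r0_def)
    then show ?thesis by (simp add: pos_less_divide_eq algebra_simps)
  qed
qed

lemma near_estimate:
  assumes \<theta>: "\<theta> \<in> \<Theta>" and \<epsilon>: "0 < \<epsilon>" "\<epsilon> < 1" and f: "f \<in> antidual"
    and r1: "0 < r1" "r1 \<le> radius_r0 a b K La Ls KZ" and near: "norm \<theta> < r1"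
  defines "e \<equiv> u_sol a b f \<epsilon> \<theta> - u0_approx a b Vs Z r1 f \<epsilon> \<theta>"
    and "D \<equiv> dual_norm (ip a b \<theta>) f"
  shows "energy a b \<epsilon> \<theta> e \<le> 8 * K\<^sup>2 / nu a b 0 * (\<epsilon>\<^sup>2 * D\<^sup>2)"
    and "qform (b \<theta>) e \<le> 16 * K ^ 4 / (nu a b 0)\<^sup>2 * (\<epsilon> ^ 4 * D\<^sup>2)"
proof -
  interpret P: form_pair "a \<theta>" "b \<theta>" by (rule form_pair[OF \<theta>])
  note small = radius_bounds[OF r1 near]
  obtain u0 where u0: "u0 \<in> {u. \<forall>w\<in>orthW a b 0. a \<theta> u w = 0}"
    "\<And>s. s \<in> {u. \<forall>w\<in>orthW a b 0. a \<theta> u w = 0} \<Longrightarrow> P.scaled_sum \<epsilon> u0 s = f s"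
    "(case vz_sol a b Vs Z f \<epsilon> \<theta> of (v, z) \<Rightarrow> v + mapM a b \<theta> z) = u0"
    by (rule vz_sol_spec[OF \<theta> small \<epsilon> f]) (rule that)
  have e: "e = u_sol a b f \<epsilon> \<theta> - u0" by (simp add: e_def u0_approx_def near u0(3))
  define \<gamma> where "\<gamma> = nu a b 0 / (2 * K\<^sup>2)"
  have nu0: "0 < nu a b 0" by (rule nu_pos[OF zero_in])
  have \<gamma>: "0 < \<gamma>" using nu0 K_pos by (simp add: \<gamma>_def)
  have coercive: "\<gamma> * (form_norm (form_sum (a \<theta>) (b \<theta>)) w)\<^sup>2 \<le> qform (a \<theta>) w"
    if w: "w \<in> orthW a b 0" for w
  proof -
    have "(tnorm a b \<theta> w)\<^sup>2 \<le> (K * tnorm a b 0 w)\<^sup>2"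
      by (intro power_mono tnorm_le[OF \<theta> zero_in]) (simp add: tnorm_eq)
    then have "\<gamma> * (tnorm a b \<theta> w)\<^sup>2 \<le> \<gamma> * (K * tnorm a b 0 w)\<^sup>2" using \<gamma> by simp
    also have "\<dots> = nu a b 0 / 2 * (tnorm a b 0 w)\<^sup>2"
      using K_pos by (simp add: \<gamma>_def power_mult_distrib)
    also have "\<dots> \<le> qform (a \<theta>) w" by (rule coercive_W[OF \<theta> small(1) w])
    finally show ?thesis by (simp add: tnorm_eq)
  qed
  have fD: "cmod (f u) \<le> \<bar>D\<bar> * form_norm (form_sum (a \<theta>) (b \<theta>)) u" for u
    using P.sum.dual_norm_bound[OF f] by (simp add: D_def ip_def)
  note estimate = P.Galerkin_error_estimate[OF \<epsilon> closed_orthW[OF zero_in] \<gamma> coercive fD abs_ge_zero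
      u_sol_spec[OF \<theta> \<epsilon> f] refl u0(1,2), folded e]
  have "energy a b \<epsilon> \<theta> e = qform (P.scaled_sum \<epsilon>) e"
    by (simp add: energy_def P.qform_scaled_sum)
  also have "\<dots> \<le> 4 / \<gamma> * (\<epsilon>\<^sup>2 * \<bar>D\<bar>\<^sup>2)" by (rule estimate(1))
  also have "4 / \<gamma> = 8 * K\<^sup>2 / nu a b 0" by (simp add: \<gamma>_def)
  finally show "energy a b \<epsilon> \<theta> e \<le> 8 * K\<^sup>2 / nu a b 0 * (\<epsilon>\<^sup>2 * D\<^sup>2)" by simp
  have "qform (b \<theta>) e \<le> 4 / \<gamma>\<^sup>2 * (\<epsilon> ^ 4 * \<bar>D\<bar>\<^sup>2)" by (rule estimate(2))
  also have "4 / \<gamma>\<^sup>2 = 16 * K ^ 4 / (nu a b 0)\<^sup>2"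
    by (simp add: \<gamma>_def power_divide power_mult_distrib flip: power_mult)
  finally show "qform (b \<theta>) e \<le> 16 * K ^ 4 / (nu a b 0)\<^sup>2 * (\<epsilon> ^ 4 * D\<^sup>2)" by simp
qed

lemma far_estimate:
  assumes \<theta>: "\<theta> \<in> \<Theta>" and \<epsilon>: "0 < \<epsilon>" "\<epsilon> < 1" and f: "f \<in> antidual"
    and far: "r1 \<le> norm \<theta>"
  defines "e \<equiv> u_sol a b f \<epsilon> \<theta> - u0_approx a b Vs Z r1 f \<epsilon> \<theta>"
    and "D \<equiv> dual_norm (ip a b \<theta>) f"
  shows "energy a b \<epsilon> \<theta> e \<le> 1 / nu a b \<theta> * (\<epsilon>\<^sup>2 * D\<^sup>2)"
    and "qform (b \<theta>) e \<le> 1 / (nu a b \<theta>)\<^sup>2 * (\<epsilon> ^ 4 * D\<^sup>2)"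
proof -
  interpret P: form_pair "a \<theta>" "b \<theta>" by (rule form_pair[OF \<theta>])
  have V: "kerV a \<theta> = P.V" by (simp add: kerV_def)
  have W: "orthW a b \<theta> = P.W" unfolding orthW_eq kerV_def ..
  define v where "v = v_sol a b f \<theta>"
  have "v \<in> P.V \<and> (\<forall>w\<in>P.V. b \<theta> v w = f w)"
    unfolding v_def v_sol_def V by (rule theI'[OF P.V_solution[OF f]])
  then have v: "v \<in> P.V" "\<And>w. w \<in> P.V \<Longrightarrow> b \<theta> v w = f w" by blast+
  have e: "e = u_sol a b f \<epsilon> \<theta> - v" using far by (simp add: e_def u0_approx_def v_def)
  have fD: "cmod (f u) \<le> \<bar>D\<bar> * form_norm (form_sum (a \<theta>) (b \<theta>)) u" for u
    using P.sum.dual_norm_bound[OF f] by (simp add: D_def ip_def)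
  note estimate = P.gap_error_estimate[OF \<epsilon> nu_pos[OF \<theta>]
      nu_le[OF \<theta>, unfolded tnorm_eq W] f fD abs_ge_zero u_sol_spec[OF \<theta> \<epsilon> f] v, folded e]
  have "energy a b \<epsilon> \<theta> e = qform (P.scaled_sum \<epsilon>) e"
    by (simp add: energy_def P.qform_scaled_sum)
  also have "\<dots> \<le> 1 / nu a b \<theta> * (\<epsilon>\<^sup>2 * \<bar>D\<bar>\<^sup>2)" by (rule estimate(1))
  finally show "energy a b \<epsilon> \<theta> e \<le> 1 / nu a b \<theta> * (\<epsilon>\<^sup>2 * D\<^sup>2)" by simp
  have "qform (b \<theta>) e \<le> 1 / (nu a b \<theta>)\<^sup>2 * (\<epsilon> ^ 4 * \<bar>D\<bar>\<^sup>2)" by (rule estimate(2))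
  then show "qform (b \<theta>) e \<le> 1 / (nu a b \<theta>)\<^sup>2 * (\<epsilon> ^ 4 * D\<^sup>2)" by simp
qed

lemma nu_inf_real:
  assumes "\<theta> \<in> \<Theta>" "0 < r" "r \<le> norm \<theta>"
  obtains n where "nu_inf \<Theta> a b r = ereal n" "0 < n" "n \<le> nu a b \<theta>"
proof -
  have "nu_inf \<Theta> a b r \<le> ereal (nu a b \<theta>)"
    unfolding nu_inf_def using assms by (intro INF_lower) simp
  with nu_inf_pos[OF assms(2)] show ?thesis
    using that by (cases "nu_inf \<Theta> a b r") auto
qed

end

theorem theorem4p8:
  fixes \<Theta> :: "(real ^ 'n::finite) set"
    and a b :: "('n, 'h::chilbert_space) form_family"
    and Vs Z :: "'h set"
    and K La Ls KZ r1 :: real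
  assumes "separable_space (euclidean :: 'h topology)"
    and "standing_assumptions \<Theta> a b K La"
    and "spectral_gap \<Theta> a b"
    and "removable_singularity \<Theta> a b Vs Ls"
    and "complementary a b Vs Z KZ"
    and "0 < r1" and "r1 \<le> radius_r0 a b K La Ls KZ"
  shows "0 < nu_inf \<Theta> a b r1 \<and>
    (\<forall>f\<in>antidual. \<forall>\<theta>\<in>\<Theta>. \<forall>\<epsilon>::real. 0 < \<epsilon> \<and> \<epsilon> < 1 \<longrightarrow>
       ereal (energy a b \<epsilon> \<theta> (u_sol a b f \<epsilon> \<theta> - u0_approx a b Vs Z r1 f \<epsilon> \<theta>))
         \<le> const_C1 \<Theta> a b K r1 * ereal (\<epsilon>\<^sup>2 * (dual_norm (ip a b \<theta>) f)\<^sup>2) \<and>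
       ereal (qform (b \<theta>) (u_sol a b f \<epsilon> \<theta> - u0_approx a b Vs Z r1 f \<epsilon> \<theta>))
         \<le> const_C2 \<Theta> a b K r1 * ereal (\<epsilon> ^ 4 * (dual_norm (ip a b \<theta>) f)\<^sup>2))"
proof -
  interpret singular_family \<Theta> a b K La Vs Z Ls KZ
    using assms by unfold_locales
  have weaken: "ereal x \<le> C * ereal y" if "x \<le> c * y" "ereal c \<le> C" "0 \<le> y" for x c y C
  proof -
    have "ereal x \<le> ereal c * ereal y" using that(1) by simp
    also have "\<dots> \<le> C * ereal y" using that(2,3) by (intro ereal_mult_right_mono) auto
    finally show ?thesis .
  qed
  show ?thesis
  proof (intro conjI ballI allI impI)
    show "0 < nu_inf \<Theta> a b r1" by (rule nu_inf_pos[OF assms(6)])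
    fix f :: "'h \<Rightarrow> complex" and \<theta> and \<epsilon> :: real
    assume f: "f \<in> antidual" and \<theta>: "\<theta> \<in> \<Theta>" and "0 < \<epsilon> \<and> \<epsilon> < 1"
    then have \<epsilon>: "0 < \<epsilon>" "\<epsilon> < 1" by auto
    let ?e = "u_sol a b f \<epsilon> \<theta> - u0_approx a b Vs Z r1 f \<epsilon> \<theta>"
    let ?D = "dual_norm (ip a b \<theta>) f"
    obtain c1 c2 where c1: "energy a b \<epsilon> \<theta> ?e \<le> c1 * (\<epsilon>\<^sup>2 * ?D\<^sup>2)" "ereal c1 \<le> const_C1 \<Theta> a b K r1"
      and c2: "qform (b \<theta>) ?e \<le> c2 * (\<epsilon> ^ 4 * ?D\<^sup>2)" "ereal c2 \<le> const_C2 \<Theta> a b K r1"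
    proof (cases "norm \<theta> < r1")
      case True
      note est = near_estimate[OF \<theta> \<epsilon> f assms(6,7) True]
      show ?thesis by (rule that[OF est(1) _ est(2)]) (simp_all add: const_C1_def const_C2_def)
    next
      case False
      then have far: "r1 \<le> norm \<theta>" by simp
      note est = far_estimate[OF \<theta> \<epsilon> f far]
      obtain n where n: "nu_inf \<Theta> a b r1 = ereal n" "0 < n" "n \<le> nu a b \<theta>"
        by (rule nu_inf_real[OF \<theta> assms(6) far])
      have "1 / nu a b \<theta> \<le> 1 / n" using n by (intro divide_left_mono) auto
      moreover have "1 / (nu a b \<theta>)\<^sup>2 \<le> 1 / n\<^sup>2"
        using n by (intro divide_left_mono power_mono) auto
      moreover have "1 / nu_inf \<Theta> a b r1 = ereal (1 / n)" "1 / (nu_inf \<Theta> a b r1)\<^sup>2 = ereal (1 / n\<^sup>2)"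
        using n by (simp_all add: one_ereal_def)
      ultimately show ?thesis
        by (intro that[OF est(1) _ est(2)]) (simp_all add: const_C1_def const_C2_def le_max_iff_disj)
    qed
    show "ereal (energy a b \<epsilon> \<theta> ?e) \<le> const_C1 \<Theta> a b K r1 * ereal (\<epsilon>\<^sup>2 * ?D\<^sup>2)"
      by (rule weaken[OF c1]) simp
    show "ereal (qform (b \<theta>) ?e) \<le> const_C2 \<Theta> a b K r1 * ereal (\<epsilon> ^ 4 * ?D\<^sup>2)"
      by (rule weaken[OF c2]) simp
  qed
qed

end
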